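(* Let $\kappa$ be an inaccessible cardinal that is fresh, either for its first-order theory, for its second-order theory, or for its $\alpha$-order theory for some absolutely definable ordinal $\alpha$. Then the next inaccessible cardinal above $\kappa$, if it exists, is first-order theory categorical.
   Context: $V_\kappa$ denotes the rank-initial segment of the cumulative hierarchy. An ordinal $\alpha$ is absolutely definable if there is a first-order formula $\psi(x)$ such that for every inaccessible $\kappa$, $\alpha\in V_\kappa$ and $\alpha$ is the unique element of $V_\kappa$ satisfying $\psi$ in $V_\kappa$. The $\alpha$-order theory of $V_\kappa$ consists of the $\alpha$-order sentences true about $V_\kappa$, these being first-order assertions about $V_{\kappa+\alpha}$ (second-order quantifiers range over all subsets of $V_\kappa$). An inaccessible cardinal $\kappa$ is fresh (for a given order) if the theory of $V_\kappa$ of that order is not the theory of that order of $V_\delta$ for any inaccessible $\delta<\kappa$. A cardinal $\kappa$ is first-order theory categorical if $\kappa$ is inaccessible and there is a first-order theory $T$ with $V_\kappa\models T$ and $V_\lambda\not\models T$ for every inaccessible $\lambda\neq\kappa$. *)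

theory Defs
  imports "HOL-Library.Equipollence" "HOL-Library.Countable_Set"
begin

text \<open>
  The set-theoretic universe: a type carrying a membership relation (\<open>elts x\<close> is the collection
  of members of \<open>x\<close>) that satisfies the ZFC axioms, with separation and replacement
  for arbitrary HOL predicates and functions. Pairing and choice are not listed because they follow:
  pairing from infinity and replacement, choice from Hilbert's operator and replacement.
\<close>

class zfc =
  fixes elts :: "'a \<Rightarrow> 'a set"
  assumes extensionality: "elts x = elts y \<Longrightarrow> x = y"
    and foundation: "wf {(x, y). x \<in> elts y}"
    and separation: "Y \<subseteq> elts x \<Longrightarrow> \<exists>y. elts y = Y"
    and replacement: "\<exists>y. elts y = f ` elts x"
    and union: "\<exists>u. elts u = \<Union> (elts ` elts x)"
    and power_set: "\<exists>p. elts p = {y. elts y \<subseteq> elts x}"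
    and infinity: "\<exists>w. (\<exists>z\<in>elts w. elts z = {}) \<and>
                       (\<forall>x\<in>elts w. \<exists>y\<in>elts w. elts y = insert x (elts x))"

text \<open>The set with a given extension; meaningful only if the collection is not a proper class.\<close>

definition set_of :: "'v::zfc set \<Rightarrow> 'v" where
  "set_of X = (THE x. elts x = X)"

lemma elts_set_of: "elts x = X \<Longrightarrow> elts (set_of X) = X"
  unfolding set_of_def by (rule theI[of _ x]) (simp_all add: extensionality)


subsection \<open>Ordinals and the cumulative hierarchy\<close>

definition transitive_set :: "'v::zfc \<Rightarrow> bool" where
  "transitive_set x \<longleftrightarrow> (\<forall>y\<in>elts x. elts y \<subseteq> elts x)"

definition ordinal :: "'v::zfc \<Rightarrow> bool" where
  "ordinal \<alpha> \<longleftrightarrow> transitive_set \<alpha> \<and> (\<forall>\<beta>\<in>elts \<alpha>. transitive_set \<beta>)"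

text \<open>
  \<open>V\<^sub>\<alpha>\<close> is the union of the power sets of \<open>V\<^sub>\<beta>\<close> for \<open>\<beta> < \<alpha>\<close>, and
  \<open>\<alpha> + \<beta>\<close> is \<open>\<alpha> \<union> {\<alpha> + \<gamma> | \<gamma> < \<beta>}\<close>; both by recursion on membership.
\<close>

definition Vrank :: "'v::zfc \<Rightarrow> 'v" where
  "Vrank = wfrec {(x, y). x \<in> elts y}
     (\<lambda>V \<alpha>. set_of (\<Union>\<beta>\<in>elts \<alpha>. {x. elts x \<subseteq> elts (V \<beta>)}))"

definition ord_add :: "'v::zfc \<Rightarrow> 'v \<Rightarrow> 'v" where
  "ord_add \<alpha> = wfrec {(x, y). x \<in> elts y} (\<lambda>A \<beta>. set_of (elts \<alpha> \<union> A ` elts \<beta>))"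

lemma ex_UN:
  fixes F :: "'v::zfc \<Rightarrow> 'v set"
  assumes "\<And>x. x \<in> elts a \<Longrightarrow> \<exists>y. elts y = F x"
  shows "\<exists>u. elts u = (\<Union>x\<in>elts a. F x)"
proof -
  define g where "g x = set_of (F x)" for x
  have g: "elts (g x) = F x" if "x \<in> elts a" for x
    using assms[OF that] unfolding g_def by (elim exE) (rule elts_set_of)
  obtain r where r: "elts r = g ` elts a"
    using replacement[where f = g and x = a] by blast
  obtain u where "elts u = \<Union> (elts ` elts r)"
    using union[of r] by blast
  then have "elts u = (\<Union>x\<in>elts a. F x)"
    using g r by simp
  then show ?thesis
    by blast
qed

lemma elts_Vrank: "elts (Vrank \<alpha>) = (\<Union>\<beta>\<in>elts \<alpha>. {x. elts x \<subseteq> elts (Vrank \<beta>)})"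
proof -
  have "Vrank \<alpha> = set_of (\<Union>\<beta>\<in>elts \<alpha>. {x. elts x \<subseteq> elts (Vrank \<beta>)})"
    by (subst def_wfrec[OF eq_reflection[OF Vrank_def] foundation]) (simp add: cut_apply)
  moreover obtain u where u: "elts u = (\<Union>\<beta>\<in>elts \<alpha>. {x. elts x \<subseteq> elts (Vrank \<beta>)})"
    using ex_UN[of \<alpha> "\<lambda>\<beta>. {x. elts x \<subseteq> elts (Vrank \<beta>)}", OF power_set] by blast
  ultimately show ?thesis
    using elts_set_of[OF u] by simp
qed

lemma ex_Un: "\<exists>u. elts u = elts x \<union> elts (y::'v::zfc)"
proof -
  obtain w z :: 'v where "z \<in> elts w" and z: "elts z = {}"
    and w: "\<forall>x\<in>elts w. \<exists>y\<in>elts w. elts y = insert x (elts x)"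
    using infinity by blast
  then obtain s where s: "s \<in> elts w" "elts s = {z}"
    by blast
  obtain p where p: "elts p = insert s (elts s)"
    using w s by blast
  have "s \<noteq> z"
    using s z by auto
  then have "(\<Union>i\<in>elts p. if i = z then elts x else elts y) = elts x \<union> elts y"
    using p s by auto
  moreover have "\<exists>u. elts u = (\<Union>i\<in>elts p. if i = z then elts x else elts y)"
    by (rule ex_UN) auto
  ultimately show ?thesis
    by simp
qed

lemma elts_ord_add: "elts (ord_add \<alpha> \<beta>) = elts \<alpha> \<union> ord_add \<alpha> ` elts \<beta>"
proof -
  have "ord_add \<alpha> \<beta> = set_of (elts \<alpha> \<union> ord_add \<alpha> ` elts \<beta>)"
    by (subst def_wfrec[OF eq_reflection[OF ord_add_def] foundation]) (simp add: cut_apply)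
  moreover obtain r where r: "elts r = ord_add \<alpha> ` elts \<beta>"
    using replacement[where f = "ord_add \<alpha>" and x = \<beta>] by blast
  obtain u where u: "elts u = elts \<alpha> \<union> ord_add \<alpha> ` elts \<beta>"
    using ex_Un[of \<alpha> r] unfolding r by blast
  ultimately show ?thesis
    using elts_set_of[OF u] by simp
qed


subsection \<open>Inaccessible cardinals\<close>

definition cardinal :: "'v::zfc \<Rightarrow> bool" where
  "cardinal \<kappa> \<longleftrightarrow> ordinal \<kappa> \<and> (\<forall>\<alpha>\<in>elts \<kappa>. \<not> elts \<alpha> \<approx> elts \<kappa>)"

definition regular_cardinal :: "'v::zfc \<Rightarrow> bool" where
  "regular_cardinal \<kappa> \<longleftrightarrow> cardinal \<kappa> \<and> infinite (elts \<kappa>) \<and>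
     (\<forall>\<alpha>\<in>elts \<kappa>. \<forall>f. f ` elts \<alpha> \<subseteq> elts \<kappa> \<longrightarrow>
        (\<exists>\<beta>\<in>elts \<kappa>. \<forall>\<xi>\<in>elts \<alpha>. f \<xi> \<in> elts \<beta>))"

definition strong_limit :: "'v::zfc \<Rightarrow> bool" where
  "strong_limit \<kappa> \<longleftrightarrow> cardinal \<kappa> \<and> (\<forall>\<alpha>\<in>elts \<kappa>. Pow (elts \<alpha>) \<prec> elts \<kappa>)"

definition inaccessible :: "'v::zfc \<Rightarrow> bool" where
  "inaccessible \<kappa> \<longleftrightarrow> uncountable (elts \<kappa>) \<and> regular_cardinal \<kappa> \<and> strong_limit \<kappa>"

definition next_inaccessible :: "'v::zfc \<Rightarrow> 'v \<Rightarrow> bool" where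
  "next_inaccessible \<kappa> \<nu> \<longleftrightarrow> inaccessible \<nu> \<and> \<kappa> \<in> elts \<nu> \<and>
     \<not> (\<exists>\<mu>. inaccessible \<mu> \<and> \<kappa> \<in> elts \<mu> \<and> \<mu> \<in> elts \<nu>)"


subsection \<open>First-order logic\<close>

text \<open>
  Formulas in the language of set theory, with de Bruijn indices: \<open>All\<close> binds index 0 and
  shifts the other indices up by one. A structure is the collection of its elements,
  with the membership relation of the universe.
\<close>

datatype fm = Mem nat nat | Eq nat nat | Neg fm | And fm fm | All fm

primrec fv :: "fm \<Rightarrow> nat set" where
  "fv (Mem i j) = {i, j}"
| "fv (Eq i j) = {i, j}"
| "fv (Neg \<phi>) = fv \<phi>"
| "fv (And \<phi> \<psi>) = fv \<phi> \<union> fv \<psi>"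
| "fv (All \<phi>) = {i. Suc i \<in> fv \<phi>}"

primrec sat :: "'v::zfc set \<Rightarrow> (nat \<Rightarrow> 'v) \<Rightarrow> fm \<Rightarrow> bool" where
  "sat M e (Mem i j) \<longleftrightarrow> e i \<in> elts (e j)"
| "sat M e (Eq i j) \<longleftrightarrow> e i = e j"
| "sat M e (Neg \<phi>) \<longleftrightarrow> \<not> sat M e \<phi>"
| "sat M e (And \<phi> \<psi>) \<longleftrightarrow> sat M e \<phi> \<and> sat M e \<psi>"
| "sat M e (All \<phi>) \<longleftrightarrow> (\<forall>x\<in>M. sat M (case_nat x e) \<phi>)"

definition sentence :: "fm \<Rightarrow> bool" where
  "sentence \<phi> \<longleftrightarrow> fv \<phi> = {}"

definition models :: "'v::zfc set \<Rightarrow> fm \<Rightarrow> bool" where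
  "models M \<phi> \<longleftrightarrow> (\<forall>e. range e \<subseteq> M \<longrightarrow> sat M e \<phi>)"

definition fo_theory :: "'v::zfc set \<Rightarrow> fm set" where
  "fo_theory M = {\<phi>. sentence \<phi> \<and> models M \<phi>}"

lemma sat_cong:
  "(\<And>i. i \<in> fv \<phi> \<Longrightarrow> e i = e' i) \<Longrightarrow> sat M e \<phi> \<longleftrightarrow> sat M e' \<phi>"
proof (induction \<phi> arbitrary: e e')
  case (Neg \<phi>)
  have "sat M e \<phi> = sat M e' \<phi>"
    by (rule Neg.IH) (use Neg.prems in simp)
  then show ?case
    by simp
next
  case (And \<phi> \<psi>)
  have "sat M e \<phi> = sat M e' \<phi>" "sat M e \<psi> = sat M e' \<psi>"
    using And.prems by (auto intro!: And.IH)
  then show ?case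
    by simp
next
  case (All \<phi>)
  have "sat M (case_nat x e) \<phi> = sat M (case_nat x e') \<phi>" for x
    using All.prems by (intro All.IH) (auto split: nat.split)
  then show ?case
    by simp
qed simp_all


subsection \<open>Second-order logic\<close>

text \<open>
  First-order and second-order variables are indexed separately; \<open>SIn i j\<close> says that the
  \<open>i\<close>-th first-order variable belongs to the \<open>j\<close>-th second-order variable.
  Second-order quantifiers range over all subsets of the structure.
\<close>

datatype sfm = SMem nat nat | SEq nat nat | SIn nat nat
  | SNeg sfm | SAnd sfm sfm | SAll1 sfm | SAll2 sfm

primrec sfv1 :: "sfm \<Rightarrow> nat set" where
  "sfv1 (SMem i j) = {i, j}"
| "sfv1 (SEq i j) = {i, j}"
| "sfv1 (SIn i j) = {i}"
| "sfv1 (SNeg \<phi>) = sfv1 \<phi>"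
| "sfv1 (SAnd \<phi> \<psi>) = sfv1 \<phi> \<union> sfv1 \<psi>"
| "sfv1 (SAll1 \<phi>) = {i. Suc i \<in> sfv1 \<phi>}"
| "sfv1 (SAll2 \<phi>) = sfv1 \<phi>"

primrec sfv2 :: "sfm \<Rightarrow> nat set" where
  "sfv2 (SMem i j) = {}"
| "sfv2 (SEq i j) = {}"
| "sfv2 (SIn i j) = {j}"
| "sfv2 (SNeg \<phi>) = sfv2 \<phi>"
| "sfv2 (SAnd \<phi> \<psi>) = sfv2 \<phi> \<union> sfv2 \<psi>"
| "sfv2 (SAll1 \<phi>) = sfv2 \<phi>"
| "sfv2 (SAll2 \<phi>) = {j. Suc j \<in> sfv2 \<phi>}"

primrec ssat :: "'v::zfc set \<Rightarrow> (nat \<Rightarrow> 'v) \<Rightarrow> (nat \<Rightarrow> 'v set) \<Rightarrow> sfm \<Rightarrow> bool" where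
  "ssat M e E (SMem i j) \<longleftrightarrow> e i \<in> elts (e j)"
| "ssat M e E (SEq i j) \<longleftrightarrow> e i = e j"
| "ssat M e E (SIn i j) \<longleftrightarrow> e i \<in> E j"
| "ssat M e E (SNeg \<phi>) \<longleftrightarrow> \<not> ssat M e E \<phi>"
| "ssat M e E (SAnd \<phi> \<psi>) \<longleftrightarrow> ssat M e E \<phi> \<and> ssat M e E \<psi>"
| "ssat M e E (SAll1 \<phi>) \<longleftrightarrow> (\<forall>x\<in>M. ssat M (case_nat x e) E \<phi>)"
| "ssat M e E (SAll2 \<phi>) \<longleftrightarrow> (\<forall>X. X \<subseteq> M \<longrightarrow> ssat M e (case_nat X E) \<phi>)"

definition so_theory :: "'v::zfc set \<Rightarrow> sfm set" where
  "so_theory M = {\<phi>. sfv1 \<phi> = {} \<and> sfv2 \<phi> = {} \<and>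
     (\<forall>e E. range e \<subseteq> M \<longrightarrow> range E \<subseteq> Pow M \<longrightarrow> ssat M e E \<phi>)}"


subsection \<open>Theories of rank-initial segments\<close>

definition first_order_theory :: "'v::zfc \<Rightarrow> fm set" where
  "first_order_theory \<kappa> = fo_theory (elts (Vrank \<kappa>))"

definition second_order_theory :: "'v::zfc \<Rightarrow> sfm set" where
  "second_order_theory \<kappa> = so_theory (elts (Vrank \<kappa>))"

definition alpha_order_theory :: "'v::zfc \<Rightarrow> 'v \<Rightarrow> fm set" where
  "alpha_order_theory \<alpha> \<kappa> = fo_theory (elts (Vrank (ord_add \<kappa> \<alpha>)))"

definition absolutely_definable :: "'v::zfc \<Rightarrow> bool" where
  "absolutely_definable \<alpha> \<longleftrightarrow> ordinal \<alpha> \<and>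
     (\<exists>\<psi>. fv \<psi> \<subseteq> {0} \<and>
        (\<forall>\<kappa>. inaccessible \<kappa> \<longrightarrow> \<alpha> \<in> elts (Vrank \<kappa>) \<and>
           (\<forall>x\<in>elts (Vrank \<kappa>). sat (elts (Vrank \<kappa>)) (\<lambda>_. x) \<psi> \<longleftrightarrow> x = \<alpha>)))"

text \<open>Freshness relative to an assignment \<open>Th\<close> of a theory to each inaccessible cardinal.\<close>

definition fresh :: "('v::zfc \<Rightarrow> 'f set) \<Rightarrow> 'v \<Rightarrow> bool" where
  "fresh Th \<kappa> \<longleftrightarrow> inaccessible \<kappa> \<and>
     \<not> (\<exists>\<delta>\<in>elts \<kappa>. inaccessible \<delta> \<and> Th \<kappa> = Th \<delta>)"

definition fo_theory_categorical :: "'v::zfc \<Rightarrow> bool" where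
  "fo_theory_categorical \<kappa> \<longleftrightarrow> inaccessible \<kappa> \<and>
     (\<exists>T. (\<forall>\<phi>\<in>T. sentence \<phi>) \<and> (\<forall>\<phi>\<in>T. models (elts (Vrank \<kappa>)) \<phi>) \<and>
        (\<forall>\<mu>. inaccessible \<mu> \<and> \<mu> \<noteq> \<kappa> \<longrightarrow> \<not> (\<forall>\<phi>\<in>T. models (elts (Vrank \<mu>)) \<phi>)))"

end

theory Submission
  imports Defs
begin

text \<open>
  The witnessing theory is the full first-order theory of \<open>V\<^sub>\<nu>\<close>. Every \<open>V\<^sub>\<mu>\<close> with \<open>\<mu>\<close> inaccessible
  correctly recognises, uniformly by one formula, which of its elements are inaccessible, what
  \<open>V\<^sub>\<delta>\<^sub>+\<^sub>\<alpha>\<close> is, and whether two of its elements are elementarily equivalent as structures. So if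
  \<open>V\<^sub>\<mu>\<close> satisfies the theory of \<open>V\<^sub>\<nu>\<close>, then it has a largest inaccessible \<open>\<rho>\<close>, which is fresh and has
  the same theory as \<open>\<kappa>\<close>. By freshness of \<open>\<kappa>\<close> and of \<open>\<rho>\<close> neither lies below the other, whence
  \<open>\<rho> = \<kappa>\<close> and \<open>\<mu> = \<nu>\<close>.
\<close>

section \<open>Sets and ordinals\<close>

text \<open>Freshness speaks about all sentences at once, so stating it in
  \<open>V\<^sub>\<mu>\<close> by one formula requires an internal notion of elementary equivalence
  (\<open>elem_equiv\<close>). That \<rho> and \<kappa> have equal theories is shown one sentence at
  a time instead: as the largest inaccessible of \<open>V\<^sub>\<nu>\<close>, \<kappa> is definable
  there without parameters, so any definable property of \<kappa> is expressed by a sentence true in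
  \<open>V\<^sub>\<nu>\<close>, and in \<open>V\<^sub>\<mu>\<close> that sentence speaks about
  \<rho>. Definability is treated semantically, for predicates on the true universe, so that hardly
  any formula has to be written down. The maximality of \<rho> depends on the height of \<mu> and is
  not absolute; it alone is handled by explicit quantifiers over the universe. The three kinds of
  freshness reduce to one, concerning the first-order theory of a set definable from \<kappa>:
  \<open>V\<^sub>\<kappa>\<close>, its power set, or
  \<open>V\<^sub>\<kappa>\<^sub>+\<^sub>\<alpha>\<close>.\<close>

definition small :: "'v::zfc set \<Rightarrow> bool" where
  "small X \<longleftrightarrow> (\<exists>x. elts x = X)"

lemma elts_set_of_small: "small X \<Longrightarrow> elts (set_of X) = X"
  unfolding small_def by (elim exE) (rule elts_set_of)

lemma small_elts: "small (elts x)"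
  by (auto simp: small_def)

lemma small_subset: "small X \<Longrightarrow> Y \<subseteq> X \<Longrightarrow> small Y"
  unfolding small_def using separation by blast

lemma small_image: "small X \<Longrightarrow> small (f ` X)" for f :: "'v::zfc \<Rightarrow> 'v"
  unfolding small_def using replacement[where f = f] by auto

lemma small_Un: "small X \<Longrightarrow> small Y \<Longrightarrow> small (X \<union> Y)"
  unfolding small_def using ex_Un by blast

lemma small_UN: "small X \<Longrightarrow> (\<And>x. x \<in> X \<Longrightarrow> small (F x)) \<Longrightarrow> small (\<Union>x\<in>X. F x)"
  for F :: "'v::zfc \<Rightarrow> 'v set"
  unfolding small_def by (elim exE) (use ex_UN[of _ F] in auto)

lemma small_Pow: "small {y. elts y \<subseteq> elts x}"
  unfolding small_def by (rule power_set)

text \<open>\<open>x\<close> is one of its own subsets, so its singleton is carved out of the power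
  set; with binary unions this yields unordered pairs.\<close>

lemma small_singleton: "small {x}"
  by (rule small_subset[OF small_Pow[of x]]) simp

lemma small_insert: "small X \<Longrightarrow> small (insert x X)"
  using small_Un[OF small_singleton] by simp

lemma small_empty: "small {}"
  by (rule small_subset[OF small_singleton]) simp

lemma elts_inject: "elts x = elts y \<longleftrightarrow> x = y"
  using extensionality by blast

lemma elts_induct [case_names step]:
  fixes x :: "'v::zfc"
  assumes "\<And>x. (\<And>y. y \<in> elts x \<Longrightarrow> P y) \<Longrightarrow> P x"
  shows "P x"
  using foundation by (induction x rule: wf_induct_rule) (use assms in blast)

lemma mem_irrefl: "x \<notin> elts x"
  using wf_not_refl[OF foundation, of x] by simp

section \<open>Basic set constructions\<close>

definition emp :: "'v::zfc" where "emp = set_of {}"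
definition upair :: "'v::zfc \<Rightarrow> 'v \<Rightarrow> 'v" where "upair x y = set_of {x, y}"
definition opair :: "'v::zfc \<Rightarrow> 'v \<Rightarrow> 'v" where "opair x y = upair (upair x x) (upair x y)"
definition vsucc :: "'v::zfc \<Rightarrow> 'v" where "vsucc x = set_of (insert x (elts x))"
definition vpow :: "'v::zfc \<Rightarrow> 'v" where "vpow x = set_of {y. elts y \<subseteq> elts x}"
definition sep :: "'v::zfc \<Rightarrow> ('v \<Rightarrow> bool) \<Rightarrow> 'v" where "sep x P = set_of {y \<in> elts x. P y}"
definition vprod :: "'v::zfc \<Rightarrow> 'v \<Rightarrow> 'v" where
  "vprod x y = set_of (\<Union>a\<in>elts x. opair a ` elts y)"

lemma elts_emp [simp]: "elts emp = {}"
  unfolding emp_def by (rule elts_set_of_small[OF small_empty])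

lemma elts_upair [simp]: "elts (upair x y) = {x, y}"
  unfolding upair_def by (intro elts_set_of_small small_insert small_empty)

lemma elts_vsucc [simp]: "elts (vsucc x) = insert x (elts x)"
  unfolding vsucc_def by (intro elts_set_of_small small_insert small_elts)

lemma elts_vpow [simp]: "elts (vpow x) = {y. elts y \<subseteq> elts x}"
  unfolding vpow_def by (rule elts_set_of_small[OF small_Pow])

lemma elts_sep [simp]: "elts (sep x P) = {y \<in> elts x. P y}"
  unfolding sep_def by (rule elts_set_of_small, rule small_subset[OF small_elts[of x]]) auto

lemma elts_vprod: "elts (vprod x y) = {opair a b |a b. a \<in> elts x \<and> b \<in> elts y}"
proof -
  have "elts (vprod x y) = (\<Union>a\<in>elts x. opair a ` elts y)"
    unfolding vprod_def by (intro elts_set_of_small small_UN small_image small_elts)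
  then show ?thesis
    by auto
qed

lemma upair_eq_iff: "upair a b = upair c d \<longleftrightarrow> {a, b} = {c, d}"
  unfolding elts_inject[symmetric] elts_upair ..

lemma opair_inject [simp]: "opair a b = opair c d \<longleftrightarrow> a = c \<and> b = d"
  unfolding opair_def upair_eq_iff doubleton_eq_iff by auto

lemma opair_in_vprod [simp]: "opair a b \<in> elts (vprod x y) \<longleftrightarrow> a \<in> elts x \<and> b \<in> elts y"
  by (auto simp: elts_vprod)

section \<open>Natural numbers\<close>

primrec num :: "nat \<Rightarrow> 'v::zfc" where
  "num 0 = emp"
| "num (Suc n) = vsucc (num n)"

definition omega :: "'v::zfc" where "omega = set_of (range num)"

text \<open>The axiom of infinity provides some inductive set, possibly with extra members;
  \<open>range num\<close> lies inside it and is therefore small.\<close>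

lemma elts_omega: "elts (omega :: 'v::zfc) = range num"
proof -
  obtain w z :: 'v where "z \<in> elts w" and z: "elts z = {}"
    and w: "\<forall>x\<in>elts w. \<exists>y\<in>elts w. elts y = insert x (elts x)"
    using infinity by blast
  have "num n \<in> elts w" for n
  proof (induction n)
    case 0
    have "z = emp"
      using z by (simp add: extensionality)
    then show ?case
      using \<open>z \<in> elts w\<close> by simp
  next
    case (Suc n)
    then obtain y where "y \<in> elts w" "elts y = insert (num n) (elts (num n))"
      using w by blast
    moreover from this have "y = vsucc (num n)"
      by (simp add: extensionality)
    ultimately show ?case
      by simp
  qed
  then have "small (range num :: 'v set)"
    by (intro small_subset[OF small_elts[of w]]) auto
  then show ?thesis
    unfolding omega_def by (rule elts_set_of_small)
qed

lemma num_mono: "m < n \<Longrightarrow> num m \<in> elts (num n)"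
  by (induction n) (auto simp: less_Suc_eq)

lemma inj_num: "inj num"
  by (rule injI) (metis num_mono mem_irrefl linorder_neqE_nat)

lemma num_eq_iff [simp]: "num m = num n \<longleftrightarrow> m = n"
  using inj_num by (auto simp: inj_def)

section \<open>Ordinals\<close>

lemma ordinal_mem: "ordinal \<alpha> \<Longrightarrow> \<beta> \<in> elts \<alpha> \<Longrightarrow> ordinal \<beta>"
  unfolding ordinal_def transitive_set_def by blast

lemma ordinal_trans: "ordinal \<alpha> \<Longrightarrow> \<beta> \<in> elts \<alpha> \<Longrightarrow> \<gamma> \<in> elts \<beta> \<Longrightarrow> \<gamma> \<in> elts \<alpha>"
  unfolding ordinal_def transitive_set_def by blast

lemma ordinal_linear:
  assumes "ordinal \<alpha>" "ordinal \<beta>"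
  shows "\<alpha> \<in> elts \<beta> \<or> \<alpha> = \<beta> \<or> \<beta> \<in> elts \<alpha>"
  using assms
proof (induction \<alpha> arbitrary: \<beta> rule: elts_induct)
  case (step \<alpha>)
  note IH = step.IH and \<alpha> = step.prems(1)
  show ?case
    using step.prems(2)
  proof (induction \<beta> rule: elts_induct)
    case (step \<beta>)
    show ?case
    proof (rule ccontr)
      assume *: "\<not> ?case"
      \<comment> \<open>The other two cases of trichotomy for \<open>a\<close> and
        \<open>\<beta>\<close> would put \<open>\<beta>\<close> into
        \<open>\<alpha>\<close>.\<close>
      have "a \<in> elts \<beta>" if "a \<in> elts \<alpha>" for a
        using IH[OF that ordinal_mem[OF \<alpha> that] step.prems] * that \<alpha> ordinal_trans by blast
      moreover have "b \<in> elts \<alpha>" if "b \<in> elts \<beta>" for b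
        using step.IH[OF that ordinal_mem[OF step.prems that]] * that step.prems ordinal_trans by blast
      ultimately have "elts \<alpha> = elts \<beta>"
        by blast
      then show False
        using * extensionality by blast
    qed
  qed
qed

lemma ordinal_subset_cases:
  assumes "ordinal \<alpha>" "ordinal \<beta>" "elts \<alpha> \<subseteq> elts \<beta>"
  shows "\<alpha> = \<beta> \<or> \<alpha> \<in> elts \<beta>"
  using ordinal_linear[OF assms(1,2)] assms(3) mem_irrefl by blast

lemma ordinal_omega: "ordinal omega"
proof -
  have "ordinal (num n :: 'a) \<and> elts (num n :: 'a) \<subseteq> range num" for n
    by (induction n) (auto simp: ordinal_def transitive_set_def)
  then show ?thesis
    unfolding ordinal_def transitive_set_def elts_omega by auto
qed

section \<open>Closure properties of the universes\<close>

lemma mem_Vrank: "x \<in> elts (Vrank \<alpha>) \<longleftrightarrow> (\<exists>\<beta>\<in>elts \<alpha>. elts x \<subseteq> elts (Vrank \<beta>))"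
  by (subst elts_Vrank) auto

lemma Vrank_memI: "\<beta> \<in> elts \<alpha> \<Longrightarrow> elts x \<subseteq> elts (Vrank \<beta>) \<Longrightarrow> x \<in> elts (Vrank \<alpha>)"
  unfolding mem_Vrank by blast

lemma Vrank_mono: "ordinal \<alpha> \<Longrightarrow> \<beta> \<in> elts \<alpha> \<Longrightarrow> elts (Vrank \<beta>) \<subseteq> elts (Vrank \<alpha>)"
  by (metis mem_Vrank ordinal_trans subsetI)

lemma Vrank_down: "x \<in> elts (Vrank \<alpha>) \<Longrightarrow> elts y \<subseteq> elts x \<Longrightarrow> y \<in> elts (Vrank \<alpha>)"
  unfolding mem_Vrank by blast

lemma Vrank_trans: "ordinal \<alpha> \<Longrightarrow> x \<in> elts (Vrank \<alpha>) \<Longrightarrow> elts x \<subseteq> elts (Vrank \<alpha>)"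
  using Vrank_mono mem_Vrank by blast

lemma ordinal_subset_Vrank: "ordinal \<alpha> \<Longrightarrow> elts \<alpha> \<subseteq> elts (Vrank \<alpha>)"
proof (induction \<alpha> rule: elts_induct)
  case (step \<alpha>)
  then show ?case
    by (metis mem_Vrank ordinal_mem subsetI)
qed

text \<open>If the members of \<open>\<beta>\<close> lie in \<open>Vrank \<gamma>\<close>, they are
  below \<open>\<gamma>\<close> by induction, so \<open>\<beta>\<close> is at most
  \<open>\<gamma>\<close>. Hence comparing inaccessibles amounts to membership in a
  universe.\<close>

lemma ordinal_in_Vrank: "ordinal \<alpha> \<Longrightarrow> ordinal \<beta> \<Longrightarrow> \<beta> \<in> elts (Vrank \<alpha>) \<longleftrightarrow> \<beta> \<in> elts \<alpha>"
proof (induction \<alpha> arbitrary: \<beta> rule: elts_induct)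
  case (step \<alpha>)
  show ?case
  proof
    assume "\<beta> \<in> elts (Vrank \<alpha>)"
    then obtain \<gamma> where \<gamma>: "\<gamma> \<in> elts \<alpha>" "elts \<beta> \<subseteq> elts (Vrank \<gamma>)"
      by (auto simp: mem_Vrank)
    then have "elts \<beta> \<subseteq> elts \<gamma>"
      using step ordinal_mem by blast
    then show "\<beta> \<in> elts \<alpha>"
      using ordinal_subset_cases[of \<beta> \<gamma>] step.prems \<gamma>(1) ordinal_mem ordinal_trans by blast
  next
    show "\<beta> \<in> elts \<alpha> \<Longrightarrow> \<beta> \<in> elts (Vrank \<alpha>)"
      using step.prems(1) ordinal_subset_Vrank by blast
  qed
qed

section \<open>Consequences of inaccessibility\<close>

lemma inaccessible_ordinal: "inaccessible \<mu> \<Longrightarrow> ordinal \<mu>"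
  by (simp add: inaccessible_def strong_limit_def cardinal_def)

lemma inaccessible_bound:
  assumes "inaccessible \<mu>" "\<alpha> \<in> elts \<mu>" "\<And>\<xi>. \<xi> \<in> elts \<alpha> \<Longrightarrow> f \<xi> \<in> elts \<mu>"
  obtains \<beta> where "\<beta> \<in> elts \<mu>" "\<And>\<xi>. \<xi> \<in> elts \<alpha> \<Longrightarrow> f \<xi> \<in> elts \<beta>"
proof -
  have "f ` elts \<alpha> \<subseteq> elts \<mu> \<longrightarrow> (\<exists>\<beta>\<in>elts \<mu>. \<forall>\<xi>\<in>elts \<alpha>. f \<xi> \<in> elts \<beta>)"
    using assms(1,2) unfolding inaccessible_def regular_cardinal_def by blast
  then show ?thesis
    using assms(3) that by blast
qed

lemma omega_in_inaccessible:
  assumes "inaccessible \<mu>"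
  shows "omega \<in> elts \<mu>"
proof (rule ccontr)
  assume "omega \<notin> elts \<mu>"
  then have "elts \<mu> \<subseteq> elts omega"
    using ordinal_linear[OF ordinal_omega inaccessible_ordinal[OF assms]]
      ordinal_trans[OF ordinal_omega] by blast
  then have "countable (elts \<mu>)"
    unfolding elts_omega by (rule countable_subset) simp
  then show False
    using assms by (simp add: inaccessible_def)
qed

text \<open>This comes from regularity: a strict bound for the constant function
  \<open>\<alpha>\<close> on \<open>omega\<close> lies above \<open>\<alpha>\<close>, the domain
  being nonempty.\<close>

lemma inaccessible_limit:
  assumes "inaccessible \<mu>" "\<alpha> \<in> elts \<mu>"
  obtains \<beta> where "\<beta> \<in> elts \<mu>" "\<alpha> \<in> elts \<beta>"
proof -
  have "emp \<in> elts omega"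
    unfolding elts_omega using num.simps(1) by (metis rangeI)
  then show ?thesis
    using inaccessible_bound[OF assms(1) omega_in_inaccessible[OF assms(1)], of "\<lambda>_. \<alpha>"] assms(2) that
    by blast
qed

abbreviation Vuniv :: "'v::zfc \<Rightarrow> 'v set" where "Vuniv \<mu> \<equiv> elts (Vrank \<mu>)"

lemma Vuniv_trans: "inaccessible \<mu> \<Longrightarrow> x \<in> Vuniv \<mu> \<Longrightarrow> y \<in> elts x \<Longrightarrow> y \<in> Vuniv \<mu>"
  using Vrank_trans inaccessible_ordinal by blast

lemma Vuniv_vpow:
  assumes "inaccessible \<mu>" "x \<in> Vuniv \<mu>"
  shows "vpow x \<in> Vuniv \<mu>"
proof -
  obtain \<beta> where \<beta>: "\<beta> \<in> elts \<mu>" "elts x \<subseteq> Vuniv \<beta>"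
    using assms(2) by (auto simp: mem_Vrank)
  obtain \<gamma> where \<gamma>: "\<gamma> \<in> elts \<mu>" "\<beta> \<in> elts \<gamma>"
    using inaccessible_limit[OF assms(1) \<beta>(1)] .
  have "elts (vpow x) \<subseteq> Vuniv \<gamma>"
    using \<beta>(2) by (auto intro!: Vrank_memI[OF \<gamma>(2)])
  then show ?thesis
    by (rule Vrank_memI[OF \<gamma>(1)])
qed

lemma Vuniv_common_rank:
  assumes "inaccessible \<mu>" "x \<in> Vuniv \<mu>" "y \<in> Vuniv \<mu>"
  obtains \<beta> where "\<beta> \<in> elts \<mu>" "elts x \<subseteq> Vuniv \<beta>" "elts y \<subseteq> Vuniv \<beta>"
proof -
  obtain \<beta> \<gamma> where *: "\<beta> \<in> elts \<mu>" "elts x \<subseteq> Vuniv \<beta>" "\<gamma> \<in> elts \<mu>" "elts y \<subseteq> Vuniv \<gamma>"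
    using assms(2,3) by (auto simp: mem_Vrank)
  then have "ordinal \<beta>" "ordinal \<gamma>"
    using assms(1) inaccessible_ordinal ordinal_mem by blast+
  then show ?thesis
    using ordinal_linear[of \<beta> \<gamma>] Vrank_mono * that by blast
qed

lemma Vuniv_upair:
  assumes "inaccessible \<mu>" "x \<in> Vuniv \<mu>" "y \<in> Vuniv \<mu>"
  shows "upair x y \<in> Vuniv \<mu>"
proof -
  obtain \<beta> where \<beta>: "\<beta> \<in> elts \<mu>" "elts x \<subseteq> Vuniv \<beta>" "elts y \<subseteq> Vuniv \<beta>"
    using Vuniv_common_rank[OF assms] .
  obtain \<gamma> where \<gamma>: "\<gamma> \<in> elts \<mu>" "\<beta> \<in> elts \<gamma>"
    using inaccessible_limit[OF assms(1) \<beta>(1)] .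
  have "elts (upair x y) \<subseteq> Vuniv \<gamma>"
    using \<beta>(2,3) by (auto intro!: Vrank_memI[OF \<gamma>(2)])
  then show ?thesis
    by (rule Vrank_memI[OF \<gamma>(1)])
qed

lemma Vuniv_Un:
  assumes "inaccessible \<mu>" "x \<in> Vuniv \<mu>" "y \<in> Vuniv \<mu>" "elts z \<subseteq> elts x \<union> elts y"
  shows "z \<in> Vuniv \<mu>"
proof -
  obtain \<beta> where \<beta>: "\<beta> \<in> elts \<mu>" "elts x \<subseteq> Vuniv \<beta>" "elts y \<subseteq> Vuniv \<beta>"
    using Vuniv_common_rank[OF assms(1-3)] .
  then show ?thesis
    using assms(4) by (intro Vrank_memI[OF \<beta>(1)]) blast
qed

lemma Vuniv_vsucc:
  assumes "inaccessible \<mu>" "x \<in> Vuniv \<mu>"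
  shows "vsucc x \<in> Vuniv \<mu>"
  by (rule Vuniv_Un[OF assms(1) Vuniv_upair[OF assms assms(2)] assms(2)]) auto

lemma Vuniv_vprod:
  assumes "inaccessible \<mu>" "x \<in> Vuniv \<mu>" "y \<in> Vuniv \<mu>"
  shows "vprod x y \<in> Vuniv \<mu>"
proof -
  define u where "u = set_of (elts x \<union> elts y)"
  have u: "elts u = elts x \<union> elts y"
    unfolding u_def by (intro elts_set_of_small small_Un small_elts)
  have "u \<in> Vuniv \<mu>"
    using Vuniv_Un[OF assms] u by simp
  then have "vpow (vpow u) \<in> Vuniv \<mu>"
    using assms(1) by (simp add: Vuniv_vpow)
  \<comment> \<open>Both members of a Kuratowski pair are subsets of \<open>u\<close>, so each pair
    is a set of subsets of \<open>u\<close>.\<close>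
  moreover have "elts (vprod x y) \<subseteq> elts (vpow (vpow u))"
    unfolding elts_vprod using u by (auto simp: opair_def)
  ultimately show ?thesis
    by (rule Vrank_down)
qed

lemma Vuniv_omega: "inaccessible \<mu> \<Longrightarrow> omega \<in> Vuniv \<mu>"
  using omega_in_inaccessible inaccessible_ordinal ordinal_subset_Vrank by blast

lemma Vuniv_emp: "inaccessible \<mu> \<Longrightarrow> emp \<in> Vuniv \<mu>"
  using Vrank_down[OF Vuniv_omega] by (metis elts_emp empty_subsetI)

section \<open>Uniform definability\<close>

primrec ren :: "(nat \<Rightarrow> nat) \<Rightarrow> fm \<Rightarrow> fm" where
  "ren f (Mem i j) = Mem (f i) (f j)"
| "ren f (Eq i j) = Eq (f i) (f j)"
| "ren f (Neg \<phi>) = Neg (ren f \<phi>)"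
| "ren f (And \<phi> \<psi>) = And (ren f \<phi>) (ren f \<psi>)"
| "ren f (All \<phi>) = All (ren (case_nat 0 (\<lambda>i. Suc (f i))) \<phi>)"

lemma sat_ren: "sat M e (ren f \<phi>) \<longleftrightarrow> sat M (\<lambda>i. e (f i)) \<phi>"
proof (induction \<phi> arbitrary: e f)
  case (All \<phi>)
  have "(\<lambda>i. case_nat x e (case_nat 0 (\<lambda>i. Suc (f i)) i)) = case_nat x (\<lambda>i. e (f i))" for x
    by (auto simp: fun_eq_iff split: nat.split)
  then show ?case
    by (simp add: All)
qed simp_all

lemma fv_ren: "fv (ren f \<phi>) \<subseteq> f ` fv \<phi>"
proof (induction \<phi> arbitrary: f)
  case (All \<phi>)
  show ?case
  proof
    fix i assume "i \<in> fv (ren f (All \<phi>))"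
    then have "Suc i \<in> fv (ren (case_nat 0 (\<lambda>i. Suc (f i))) \<phi>)"
      by simp
    then obtain j where "j \<in> fv \<phi>" "Suc i = case_nat 0 (\<lambda>i. Suc (f i)) j"
      using All by blast
    then show "i \<in> f ` fv (All \<phi>)"
      by (cases j) auto
  qed
next
  case (And \<phi> \<psi>)
  then show ?case
    by (simp add: image_Un le_supI1 le_supI2)
qed auto

text \<open>One formula must serve every inaccessible \<open>\<mu>\<close>, while \<open>P\<close>
  is evaluated in the full universe. Absoluteness of \<open>P\<close> is thus part of the
  notion.\<close>

definition definable :: "((nat \<Rightarrow> 'v::zfc) \<Rightarrow> bool) \<Rightarrow> bool" where
  "definable P \<longleftrightarrow> (\<exists>\<phi>. \<forall>\<mu> e. inaccessible \<mu> \<longrightarrow> range e \<subseteq> Vuniv \<mu> \<longrightarrow>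
     (sat (Vuniv \<mu>) e \<phi> \<longleftrightarrow> P e))"

text \<open>The graph has the value at index 0 and the arguments shifted up. Closure of the
  universes is required so that a value can be the witness of a quantifier.\<close>

definition definable_fun :: "((nat \<Rightarrow> 'v::zfc) \<Rightarrow> 'v) \<Rightarrow> bool" where
  "definable_fun F \<longleftrightarrow>
     (\<forall>\<mu> e. inaccessible \<mu> \<longrightarrow> range e \<subseteq> Vuniv \<mu> \<longrightarrow> F e \<in> Vuniv \<mu>) \<and>
     definable (\<lambda>e. e 0 = F (\<lambda>i. e (Suc i)))"

lemma definableI:
  assumes "\<And>\<mu> e. inaccessible \<mu> \<Longrightarrow> range e \<subseteq> Vuniv \<mu> \<Longrightarrow> sat (Vuniv \<mu>) e \<phi> \<longleftrightarrow> P e"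
  shows "definable P"
  using assms unfolding definable_def by blast

lemma definable_cong:
  assumes "definable P"
    and "\<And>\<mu> e. inaccessible \<mu> \<Longrightarrow> range e \<subseteq> Vuniv \<mu> \<Longrightarrow> P e \<longleftrightarrow> Q e"
  shows "definable Q"
proof -
  obtain \<phi> where
    "\<And>\<mu> e. inaccessible \<mu> \<Longrightarrow> range e \<subseteq> Vuniv \<mu> \<Longrightarrow> sat (Vuniv \<mu>) e \<phi> \<longleftrightarrow> P e"
    using assms(1) unfolding definable_def by blast
  with assms(2) show ?thesis
    by (intro definableI[of \<phi>]) simp
qed

lemma definable_fun_closed:
  "definable_fun F \<Longrightarrow> inaccessible \<mu> \<Longrightarrow> range e \<subseteq> Vuniv \<mu> \<Longrightarrow> F e \<in> Vuniv \<mu>"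
  unfolding definable_fun_def by blast

lemma definable_fun_graph: "definable_fun F \<Longrightarrow> definable (\<lambda>e. e 0 = F (\<lambda>i. e (Suc i)))"
  unfolding definable_fun_def by blast

lemma definable_rename:
  assumes "definable P"
  shows "definable (\<lambda>e. P (\<lambda>i. e (f i)))"
proof -
  obtain \<phi> where \<phi>:
    "\<And>\<mu> e. inaccessible \<mu> \<Longrightarrow> range e \<subseteq> Vuniv \<mu> \<Longrightarrow> sat (Vuniv \<mu>) e \<phi> \<longleftrightarrow> P e"
    using assms unfolding definable_def by blast
  show ?thesis
    by (rule definableI[of "ren f \<phi>"]) (auto simp: sat_ren intro!: \<phi>)
qed

text \<open>
  Bound variables are handled by de Bruijn shifting of the environment: a body \<open>P e x\<close> is definable
  with \<open>x\<close> read off index 0 and \<open>e\<close> off the remaining indices. In this form the rules \<open>defn\<close>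
  decompose a predicate by unification alone.
\<close>

named_theorems defn

lemma definable_not [defn]:
  assumes "definable P"
  shows "definable (\<lambda>e. \<not> P e)"
proof -
  obtain \<phi> where
    "\<And>\<mu> e. inaccessible \<mu> \<Longrightarrow> range e \<subseteq> Vuniv \<mu> \<Longrightarrow> sat (Vuniv \<mu>) e \<phi> \<longleftrightarrow> P e"
    using assms unfolding definable_def by blast
  then show ?thesis
    by (intro definableI[of "Neg \<phi>"]) simp
qed

lemma definable_and [defn]:
  assumes "definable P" "definable Q"
  shows "definable (\<lambda>e. P e \<and> Q e)"
proof -
  obtain \<phi> where \<phi>:
    "\<And>\<mu> e. inaccessible \<mu> \<Longrightarrow> range e \<subseteq> Vuniv \<mu> \<Longrightarrow> sat (Vuniv \<mu>) e \<phi> \<longleftrightarrow> P e"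
    using assms(1) unfolding definable_def by blast
  obtain \<psi> where
    "\<And>\<mu> e. inaccessible \<mu> \<Longrightarrow> range e \<subseteq> Vuniv \<mu> \<Longrightarrow> sat (Vuniv \<mu>) e \<psi> \<longleftrightarrow> Q e"
    using assms(2) unfolding definable_def by blast
  with \<phi> show ?thesis
    by (intro definableI[of "And \<phi> \<psi>"]) simp
qed

lemma definable_or [defn]:
  "definable P \<Longrightarrow> definable Q \<Longrightarrow> definable (\<lambda>e. P e \<or> Q e)"
  using definable_not[OF definable_and[OF definable_not[of P] definable_not[of Q]]] by simp

lemma definable_imp [defn]:
  "definable P \<Longrightarrow> definable Q \<Longrightarrow> definable (\<lambda>e. P e \<longrightarrow> Q e)"
  unfolding imp_conv_disj by (intro defn)

lemma definable_iff [defn]: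
  "definable P \<Longrightarrow> definable Q \<Longrightarrow> definable (\<lambda>e. P e \<longleftrightarrow> Q e)"
  unfolding iff_conv_conj_imp by (intro defn)

lemma range_case_nat: "range (case_nat x e) = insert x (range e)"
  by (force split: nat.splits)

text \<open>The formula quantifies over \<open>Vuniv \<mu>\<close> only; the second premise places
  every counterexample there, so both readings of the quantifier agree.\<close>

lemma definable_all:
  assumes "definable (\<lambda>e. P (\<lambda>i. e (Suc i)) (e 0))"
    and "\<And>\<mu> e x. inaccessible \<mu> \<Longrightarrow> range e \<subseteq> Vuniv \<mu> \<Longrightarrow> \<not> P e x \<Longrightarrow> x \<in> Vuniv \<mu>"
  shows "definable (\<lambda>e. \<forall>x. P e x)"
proof -
  obtain \<phi> where \<phi>: "\<And>\<mu> e. inaccessible \<mu> \<Longrightarrow> range e \<subseteq> Vuniv \<mu> \<Longrightarrow>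
      sat (Vuniv \<mu>) e \<phi> \<longleftrightarrow> P (\<lambda>i. e (Suc i)) (e 0)"
    using assms(1) unfolding definable_def by blast
  show ?thesis
  proof (rule definableI[of "All \<phi>"])
    fix \<mu> :: 'a and e :: "nat \<Rightarrow> 'a"
    assume *: "inaccessible \<mu>" "range e \<subseteq> Vuniv \<mu>"
    have "sat (Vuniv \<mu>) (case_nat x e) \<phi> \<longleftrightarrow> P e x" if "x \<in> Vuniv \<mu>" for x
      using \<phi>[OF *(1), of "case_nat x e"] *(2) that by (simp add: range_case_nat)
    then show "sat (Vuniv \<mu>) e (All \<phi>) \<longleftrightarrow> (\<forall>x. P e x)"
      using assms(2)[OF *] by auto
  qed
qed

lemma definable_ex:
  assumes "definable (\<lambda>e. P (\<lambda>i. e (Suc i)) (e 0))"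
    and "\<And>\<mu> e x. inaccessible \<mu> \<Longrightarrow> range e \<subseteq> Vuniv \<mu> \<Longrightarrow> P e x \<Longrightarrow> x \<in> Vuniv \<mu>"
  shows "definable (\<lambda>e. \<exists>x. P e x)"
  using definable_not[OF definable_all[of "\<lambda>e x. \<not> P e x", OF definable_not[OF assms(1)]]] assms(2)
  by simp

text \<open>The language has no terms, so \<open>F\<close> is eliminated through its graph, with an
  existential quantifier for the value.\<close>

lemma definable_subst:
  assumes "definable (\<lambda>e. P (e 0) (\<lambda>i. e (Suc i)))" "definable_fun F"
  shows "definable (\<lambda>e. P (F e) e)"
proof -
  have "definable (\<lambda>e. \<exists>x. x = F e \<and> P x e)"
    by (rule definable_ex)
      (auto intro!: definable_and definable_fun_graph assms dest: definable_fun_closed[OF assms(2)])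
  then show ?thesis
    by simp
qed

lemma definable_fun_rename:
  assumes "definable_fun F"
  shows "definable_fun (\<lambda>e. F (\<lambda>i. e (f i)))"
proof -
  have "F (\<lambda>i. e (f i)) \<in> Vuniv \<mu>" if "inaccessible \<mu>" "range e \<subseteq> Vuniv \<mu>" for \<mu> e
    using that by (intro definable_fun_closed[OF assms]) auto
  then show ?thesis
    using definable_rename[OF definable_fun_graph[OF assms], of "case_nat 0 (\<lambda>i. Suc (f i))"]
    by (simp add: definable_fun_def)
qed

lemmas definable_fun_shift = definable_fun_rename[where f = Suc]

lemma definable_comp1:
  assumes "definable (\<lambda>e. p (e 0))" "definable_fun F"
  shows "definable (\<lambda>e. p (F e))"
  using definable_subst[of "\<lambda>x _. p x"] assms by simp

lemma definable_comp2:
  assumes "definable (\<lambda>e. p (e 0) (e 1))" "definable_fun F" "definable_fun G"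
  shows "definable (\<lambda>e. p (F e) (G e))"
proof (rule definable_subst[of "\<lambda>x e. p x (G e)", OF _ assms(2)])
  show "definable (\<lambda>e. p (e 0) (G (\<lambda>i. e (Suc i))))"
    \<comment> \<open>The argument being substituted is always read off index 0, so the renaming
      exchanges the two indices.\<close>
    using definable_subst[of "\<lambda>x e. p (e 0) x", OF _ definable_fun_rename[OF assms(3), of Suc]]
      definable_rename[OF assms(1), of "case_nat 1 (\<lambda>_. 0)"] by simp
qed

lemma definable_comp3:
  assumes "definable (\<lambda>e. p (e 0) (e 1) (e 2))"
    "definable_fun F" "definable_fun G" "definable_fun H"
  shows "definable (\<lambda>e. p (F e) (G e) (H e))"
proof (rule definable_subst[of "\<lambda>x e. p x (G e) (H e)", OF _ assms(2)])
  have "definable (\<lambda>e. p (e 1) (e 0) (H (\<lambda>i. e (Suc (Suc i)))))"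
    using definable_subst[of "\<lambda>x e. p (e 1) (e 0) x",
        OF _ definable_fun_rename[OF assms(4), of "\<lambda>i. Suc (Suc i)"]]
      definable_rename[OF assms(1), of "case_nat 2 (case_nat 1 (\<lambda>_. 0))"]
    by (simp add: numeral_2_eq_2)
  then show "definable (\<lambda>e. p (e 0) (G (\<lambda>i. e (Suc i))) (H (\<lambda>i. e (Suc i))))"
    using definable_subst[of "\<lambda>x e. p (e 0) x (H (\<lambda>i. e (Suc i)))",
        OF _ definable_fun_rename[OF assms(3), of Suc]] by simp
qed

section \<open>Definability of elementary set operations\<close>

lemma definable_mem [defn]:
  "definable_fun F \<Longrightarrow> definable_fun G \<Longrightarrow> definable (\<lambda>e. F e \<in> elts (G e))"
  by (rule definable_comp2, rule definableI[of "Mem 0 1"]) simp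

lemma definable_eq [defn]:
  "definable_fun F \<Longrightarrow> definable_fun G \<Longrightarrow> definable (\<lambda>e. F e = G e)"
  by (rule definable_comp2, rule definableI[of "Eq 0 1"]) simp

lemma definable_fun_var [defn]: "definable_fun (\<lambda>e. e n)"
  unfolding definable_fun_def by (auto intro: definableI[of "Eq 0 (Suc n)"])

lemma definable_ball [defn]:
  assumes "definable_fun F" "definable (\<lambda>e. P (\<lambda>i. e (Suc i)) (e 0))"
  shows "definable (\<lambda>e. \<forall>x\<in>elts (F e). P e x)"
  unfolding Ball_def
proof (rule definable_all)
  show "definable (\<lambda>e. e 0 \<in> elts (F (\<lambda>i. e (Suc i))) \<longrightarrow> P (\<lambda>i. e (Suc i)) (e 0))"
    by (intro defn definable_fun_shift[OF assms(1)] assms(2))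
qed (auto dest: definable_fun_closed[OF assms(1)] intro: Vuniv_trans)

lemma definable_bex [defn]:
  assumes "definable_fun F" "definable (\<lambda>e. P (\<lambda>i. e (Suc i)) (e 0))"
  shows "definable (\<lambda>e. \<exists>x\<in>elts (F e). P e x)"
  using definable_not[OF definable_ball[of F "\<lambda>e x. \<not> P e x", OF assms(1) definable_not[OF assms(2)]]]
  by simp

lemma definable_subset [defn]:
  assumes "definable_fun F" "definable_fun G"
  shows "definable (\<lambda>e. elts (F e) \<subseteq> elts (G e))"
  unfolding subset_eq by (intro defn assms(1) definable_fun_shift[OF assms(2)])

lemma definable_funI:
  assumes "definable (\<lambda>e. e 0 = h (\<lambda>i. e (Suc i)))"
    and "\<And>\<mu> e. inaccessible \<mu> \<Longrightarrow> range e \<subseteq> Vuniv \<mu> \<Longrightarrow> h e \<in> Vuniv \<mu>"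
  shows "definable_fun h"
  using assms unfolding definable_fun_def by blast

lemma definable_fun_comp1:
  assumes "definable (\<lambda>e. e 0 = h (e 1))"
    and "\<And>\<mu> x. inaccessible \<mu> \<Longrightarrow> x \<in> Vuniv \<mu> \<Longrightarrow> h x \<in> Vuniv \<mu>"
    and "definable_fun F"
  shows "definable_fun (\<lambda>e. h (F e))"
proof (rule definable_funI)
  show "definable (\<lambda>e. e 0 = h (F (\<lambda>i. e (Suc i))))"
    by (rule definable_comp2[of "\<lambda>x y. x = h y", OF assms(1)])
      (intro defn definable_fun_shift[OF assms(3)])+
qed (intro assms(2) definable_fun_closed[OF assms(3)])

lemma definable_fun_comp2:
  assumes "definable (\<lambda>e. e 0 = h (e 1) (e 2))"
    and "\<And>\<mu> x y. inaccessible \<mu> \<Longrightarrow> x \<in> Vuniv \<mu> \<Longrightarrow> y \<in> Vuniv \<mu> \<Longrightarrow> h x y \<in> Vuniv \<mu>"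
    and "definable_fun F" "definable_fun G"
  shows "definable_fun (\<lambda>e. h (F e) (G e))"
proof (rule definable_funI)
  show "definable (\<lambda>e. e 0 = h (F (\<lambda>i. e (Suc i))) (G (\<lambda>i. e (Suc i))))"
    by (rule definable_comp3[of "\<lambda>x y z. x = h y z", OF assms(1)])
      (intro defn definable_fun_shift[OF assms(3)] definable_fun_shift[OF assms(4)])+
qed (intro assms(2) definable_fun_closed[OF assms(3)] definable_fun_closed[OF assms(4)])

lemma definable_fun_sep [defn]:
  assumes "definable_fun F" "definable (\<lambda>e. P (\<lambda>i. e (Suc i)) (e 0))"
  shows "definable_fun (\<lambda>e. sep (F e) (P e))"
proof (rule definable_funI)
  have P: "definable (\<lambda>e. P (\<lambda>i. e (Suc (Suc i))) (e 0))"
    using definable_rename[OF assms(2), of "case_nat 0 (\<lambda>i. Suc (Suc i))"] by simp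
  have "definable (\<lambda>e. (\<forall>x\<in>elts (e 0). x \<in> elts (F (\<lambda>i. e (Suc i))) \<and> P (\<lambda>i. e (Suc i)) x) \<and>
      (\<forall>x\<in>elts (F (\<lambda>i. e (Suc i))). P (\<lambda>i. e (Suc i)) x \<longrightarrow> x \<in> elts (e 0)))"
    by (intro defn definable_fun_shift[OF assms(1)] P
        definable_fun_rename[OF assms(1), of "\<lambda>i. Suc (Suc i)"])
  moreover have "(\<forall>x\<in>elts a. x \<in> elts b \<and> Q x) \<and> (\<forall>x\<in>elts b. Q x \<longrightarrow> x \<in> elts a) \<longleftrightarrow> a = sep b Q"
    for a b :: 'a and Q
    unfolding elts_inject[of a, symmetric] by auto
  ultimately show "definable (\<lambda>e. e 0 = sep (F (\<lambda>i. e (Suc i))) (P (\<lambda>i. e (Suc i))))"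
    by simp
qed (rule Vrank_down[OF definable_fun_closed[OF assms(1)]], auto)

lemma definable_fun_emp [defn]: "definable_fun (\<lambda>e. emp)"
proof (rule definable_funI)
  have "definable (\<lambda>e. \<forall>x\<in>elts (e 0). \<not> x = x)"
    by (intro defn)
  then show "definable (\<lambda>e. e 0 = emp)"
    by (simp flip: elts_inject)
qed (rule Vuniv_emp)

lemma definable_fun_upair [defn]:
  assumes "definable_fun F" "definable_fun G"
  shows "definable_fun (\<lambda>e. upair (F e) (G e))"
proof (rule definable_fun_comp2[OF _ Vuniv_upair assms])
  have "definable (\<lambda>e. e 1 \<in> elts (e 0) \<and> e 2 \<in> elts (e 0) \<and> (\<forall>x\<in>elts (e 0). x = e 1 \<or> x = e 2))"
    by (intro defn)
  then show "definable (\<lambda>e. e 0 = upair (e 1) (e 2))"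
    by (rule definable_cong) (auto simp flip: elts_inject)
qed

lemma definable_fun_opair [defn]:
  assumes "definable_fun F" "definable_fun G"
  shows "definable_fun (\<lambda>e. opair (F e) (G e))"
  unfolding opair_def by (intro defn assms)

lemma definable_fun_vsucc [defn]:
  assumes "definable_fun F"
  shows "definable_fun (\<lambda>e. vsucc (F e))"
proof (rule definable_fun_comp1[OF _ Vuniv_vsucc assms])
  have "definable (\<lambda>e. e 1 \<in> elts (e 0) \<and> elts (e 1) \<subseteq> elts (e 0) \<and>
      (\<forall>x\<in>elts (e 0). x = e 1 \<or> x \<in> elts (e 1)))"
    by (intro defn)
  then show "definable (\<lambda>e. e 0 = vsucc (e 1))"
    by (rule definable_cong) (auto simp flip: elts_inject)
qed

text \<open>A universe contains all true subsets of its members, so its power sets are the true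
  ones. This makes quantifiers over arbitrary subsets, relations and functions on a set into bounded
  quantifiers.\<close>

lemma definable_fun_vpow [defn]:
  assumes "definable_fun F"
  shows "definable_fun (\<lambda>e. vpow (F e))"
proof (rule definable_fun_comp1[OF _ Vuniv_vpow assms])
  have "definable (\<lambda>e :: nat \<Rightarrow> 'a. \<forall>x. x \<in> elts (e 0) \<longleftrightarrow> elts x \<subseteq> elts (e 1))"
  proof (rule definable_all)
    fix \<mu> x :: 'a and e :: "nat \<Rightarrow> 'a"
    assume *: "inaccessible \<mu>" "range e \<subseteq> Vuniv \<mu>"
      and "\<not> (x \<in> elts (e 0) \<longleftrightarrow> elts x \<subseteq> elts (e 1))"
    then consider "x \<in> elts (e 0)" | "elts x \<subseteq> elts (e 1)"
      by blast
    then show "x \<in> Vuniv \<mu>"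
      using Vuniv_trans[OF *(1), of "e 0"] Vrank_down[of "e 1" \<mu>] *(2) by cases blast+
  qed (intro defn)
  then show "definable (\<lambda>e :: nat \<Rightarrow> 'a. e 0 = vpow (e 1))"
    by (rule definable_cong) (auto simp flip: elts_inject)
qed

lemma definable_fun_vprod [defn]:
  assumes "definable_fun F" "definable_fun G"
  shows "definable_fun (\<lambda>e. vprod (F e) (G e))"
proof (rule definable_fun_comp2[OF _ Vuniv_vprod assms])
  have "definable (\<lambda>e. (\<forall>z\<in>elts (e 0). \<exists>x\<in>elts (e 1). \<exists>y\<in>elts (e 2). z = opair x y) \<and>
      (\<forall>x\<in>elts (e 1). \<forall>y\<in>elts (e 2). opair x y \<in> elts (e 0)))"
    by (intro defn)
  then show "definable (\<lambda>e. e 0 = vprod (e 1) (e 2))"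
    by (rule definable_cong) (auto simp: elts_vprod elts_inject[symmetric, of _ "vprod a b" for a b])
qed

text \<open>\<open>omega\<close> is characterised as the inductive set with no proper inductive
  subset, which needs only a quantifier bounded by its power set.\<close>

lemma definable_fun_omega [defn]: "definable_fun (\<lambda>e. omega)"
proof (rule definable_funI)
  have "definable (\<lambda>e :: nat \<Rightarrow> 'a. emp \<in> elts (e 0) \<and> (\<forall>x\<in>elts (e 0). vsucc x \<in> elts (e 0)) \<and>
     (\<forall>s\<in>elts (vpow (e 0)). emp \<in> elts s \<and> (\<forall>x\<in>elts s. vsucc x \<in> elts s) \<longrightarrow> s = e 0))"
    by (intro defn)
  then show "definable (\<lambda>e :: nat \<Rightarrow> 'a. e 0 = omega)"
  proof (rule definable_cong)
    fix e :: "nat \<Rightarrow> 'a"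
    have num: "num n \<in> elts w" if "emp \<in> elts w" "\<forall>x\<in>elts w. vsucc x \<in> elts w" for w :: 'a and n
      by (induction n) (use that in simp_all)
    have succ: "vsucc x \<in> elts omega" if "x \<in> elts omega" for x :: 'a
      using that unfolding elts_omega by (metis imageE num.simps(2) rangeI)
    have emp: "emp \<in> elts (omega :: 'a)"
      unfolding elts_omega by (metis num.simps(1) rangeI)
    have sub: "elts omega \<subseteq> elts w" if "emp \<in> elts w" "\<forall>x\<in>elts w. vsucc x \<in> elts w" for w :: 'a
      using num[OF that] by (auto simp: elts_omega)
    show "(emp \<in> elts (e 0) \<and> (\<forall>x\<in>elts (e 0). vsucc x \<in> elts (e 0)) \<and>
      (\<forall>s\<in>elts (vpow (e 0)). emp \<in> elts s \<and> (\<forall>x\<in>elts s. vsucc x \<in> elts s) \<longrightarrow> s = e 0)) \<longleftrightarrow>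
      e 0 = omega" (is "?L \<longleftrightarrow> _")
    proof
      assume ?L
      then show "e 0 = omega"
        using sub[of "e 0"] emp succ by auto
    next
      assume "e 0 = omega"
      then show ?L
        using sub emp succ by (auto intro!: extensionality)
    qed
  qed
qed (rule Vuniv_omega)

lemma definable_ordinal [defn]:
  assumes "definable_fun F"
  shows "definable (\<lambda>e. ordinal (F e))"
  by (rule definable_comp1[OF _ assms], unfold ordinal_def transitive_set_def) (intro defn)

section \<open>Definability of the cumulative hierarchy\<close>

text \<open>
  The hierarchy built on top of a set \<open>a\<close>. It gives \<open>V\<^sub>\<kappa>\<^sub>+\<^sub>\<alpha>\<close> by a recursion of
  length \<open>\<alpha>\<close> over \<open>V\<^sub>\<kappa>\<close>, without reference to ordinal addition.
\<close>

definition hier :: "'v::zfc \<Rightarrow> 'v \<Rightarrow> 'v" where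
  "hier a = wfrec {(x, y). x \<in> elts y}
     (\<lambda>H \<alpha>. set_of (elts a \<union> (\<Union>\<beta>\<in>elts \<alpha>. {x. elts x \<subseteq> elts (H \<beta>)})))"

lemma elts_hier:
  "elts (hier a \<alpha>) = elts a \<union> (\<Union>\<beta>\<in>elts \<alpha>. {x. elts x \<subseteq> elts (hier a \<beta>)})"
proof -
  have "hier a \<alpha> = set_of (elts a \<union> (\<Union>\<beta>\<in>elts \<alpha>. {x. elts x \<subseteq> elts (hier a \<beta>)}))"
    by (subst def_wfrec[OF eq_reflection[OF hier_def] foundation]) (simp add: cut_apply)
  then show ?thesis
    by (simp add: elts_set_of_small small_Un small_UN small_elts small_Pow)
qed

lemma mem_hier: "x \<in> elts (hier a \<alpha>) \<longleftrightarrow> x \<in> elts a \<or> (\<exists>\<beta>\<in>elts \<alpha>. elts x \<subseteq> elts (hier a \<beta>))"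
  by (subst elts_hier) auto

lemma hier_emp: "hier emp \<alpha> = Vrank \<alpha>"
proof (induction \<alpha> rule: elts_induct)
  case (step \<alpha>)
  then show ?case
    by (intro extensionality) (simp add: elts_hier[of emp \<alpha>] elts_Vrank[of \<alpha>])
qed

text \<open>The members of \<open>ord_add \<kappa> \<alpha>\<close> are those of
  \<open>\<kappa>\<close>, which contribute \<open>Vrank \<kappa>\<close>, and the sums with members
  of \<open>\<alpha>\<close>, which match the recursive clause of \<open>hier\<close>.\<close>

lemma hier_Vrank: "hier (Vrank \<kappa>) \<alpha> = Vrank (ord_add \<kappa> \<alpha>)"
proof (induction \<alpha> rule: elts_induct)
  case (step \<alpha>)
  then show ?case
    by (intro extensionality)
      (simp add: elts_hier[of "Vrank \<kappa>" \<alpha>] elts_Vrank[of "ord_add \<kappa> \<alpha>"] elts_Vrank[of \<kappa>]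
        elts_ord_add UN_Un)
qed

text \<open>Regularity bounds the ranks of all earlier stages by one \<open>\<gamma>\<close>, so
  everything added to \<open>a\<close> lies in \<open>Vuniv \<gamma>\<close>.\<close>

lemma Vuniv_hier:
  assumes \<mu>: "inaccessible \<mu>" and a: "a \<in> Vuniv \<mu>"
  shows "\<alpha> \<in> elts \<mu> \<Longrightarrow> hier a \<alpha> \<in> Vuniv \<mu>"
proof (induction \<alpha> rule: elts_induct)
  case (step \<alpha>)
  have "\<exists>\<gamma>\<in>elts \<mu>. elts (hier a \<beta>) \<subseteq> Vuniv \<gamma>" if "\<beta> \<in> elts \<alpha>" for \<beta>
    using step.IH[OF that] step.prems that ordinal_trans inaccessible_ordinal[OF \<mu>]
    unfolding mem_Vrank by blast
  then obtain f where f: "\<And>\<beta>. \<beta> \<in> elts \<alpha> \<Longrightarrow> f \<beta> \<in> elts \<mu> \<and> elts (hier a \<beta>) \<subseteq> Vuniv (f \<beta>)"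
    by metis
  obtain \<gamma> where \<gamma>: "\<gamma> \<in> elts \<mu>" "\<And>\<beta>. \<beta> \<in> elts \<alpha> \<Longrightarrow> f \<beta> \<in> elts \<gamma>"
    using inaccessible_bound[OF \<mu> step.prems, of f] f by blast
  have "x \<in> Vuniv \<gamma>" if "\<beta> \<in> elts \<alpha>" "elts x \<subseteq> elts (hier a \<beta>)" for x \<beta>
    using Vrank_memI[OF \<gamma>(2)[OF that(1)]] f[OF that(1)] that(2) by blast
  then have "elts (hier a \<alpha>) \<subseteq> elts a \<union> Vuniv \<gamma>"
    by (auto simp: mem_hier[of _ a \<alpha>])
  moreover have "Vrank \<gamma> \<in> Vuniv \<mu>"
    using Vrank_memI[OF \<gamma>(1)] by blast
  ultimately show ?case
    using Vuniv_Un[OF \<mu> a] by blast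
qed

text \<open>
  The recursion is witnessed by the relation \<open>g\<close> whose section at \<open>\<beta> \<in> \<alpha>\<close> is the stage
  \<open>hier a \<beta>\<close>; all quantifiers are bounded.
\<close>

definition hier_graph :: "'v::zfc \<Rightarrow> 'v \<Rightarrow> 'v \<Rightarrow> bool" where
  "hier_graph y a \<alpha> \<longleftrightarrow> (\<exists>g\<in>elts (vpow (vprod \<alpha> y)).
     (\<forall>\<beta>\<in>elts \<alpha>. \<forall>x\<in>elts y. opair \<beta> x \<in> elts g \<longleftrightarrow>
        x \<in> elts a \<or> (\<exists>\<gamma>\<in>elts \<beta>. \<forall>z\<in>elts x. opair \<gamma> z \<in> elts g)) \<and>
     (\<forall>x\<in>elts y. x \<in> elts a \<or> (\<exists>\<gamma>\<in>elts \<alpha>. \<forall>z\<in>elts x. opair \<gamma> z \<in> elts g)) \<and>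
     elts a \<subseteq> elts y \<and>
     (\<forall>\<gamma>\<in>elts \<alpha>. \<forall>x\<in>elts (vpow y). (\<forall>z\<in>elts x. opair \<gamma> z \<in> elts g) \<longrightarrow> x \<in> elts y))"

lemma hier_graph_hier:
  assumes "ordinal \<alpha>"
  shows "hier_graph (hier a \<alpha>) a \<alpha>"
proof -
  \<comment> \<open>Monotonicity lets all stages be coded inside the product of
    \<open>\<alpha>\<close> with the final stage, the bound that \<open>hier_graph\<close> puts on
    \<open>g\<close>.\<close>
  have sub: "elts (hier a \<beta>) \<subseteq> elts (hier a \<alpha>)" if "\<beta> \<in> elts \<alpha>" for \<beta>
    using ordinal_trans[OF assms that] unfolding elts_hier[of a \<beta>] elts_hier[of a \<alpha>] by blast
  define g where "g = sep (vprod \<alpha> (hier a \<alpha>)) (\<lambda>p. \<exists>\<beta> x. p = opair \<beta> x \<and> x \<in> elts (hier a \<beta>))"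
  have g: "opair \<beta> x \<in> elts g \<longleftrightarrow> \<beta> \<in> elts \<alpha> \<and> x \<in> elts (hier a \<beta>)" for \<beta> x
    unfolding g_def using sub by auto
  have "g \<in> elts (vpow (vprod \<alpha> (hier a \<alpha>)))"
    by (auto simp: g_def)
  moreover have "\<forall>\<beta>\<in>elts \<alpha>. \<forall>x\<in>elts (hier a \<alpha>). opair \<beta> x \<in> elts g \<longleftrightarrow>
      x \<in> elts a \<or> (\<exists>\<gamma>\<in>elts \<beta>. \<forall>z\<in>elts x. opair \<gamma> z \<in> elts g)"
  proof (intro ballI)
    fix \<beta> x
    assume \<beta>: "\<beta> \<in> elts \<alpha>"
    have "(\<exists>\<gamma>\<in>elts \<beta>. \<forall>z\<in>elts x. opair \<gamma> z \<in> elts g) \<longleftrightarrow> (\<exists>\<gamma>\<in>elts \<beta>. elts x \<subseteq> elts (hier a \<gamma>))"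
      unfolding g using ordinal_trans[OF assms \<beta>] by blast
    then show "opair \<beta> x \<in> elts g \<longleftrightarrow>
        x \<in> elts a \<or> (\<exists>\<gamma>\<in>elts \<beta>. \<forall>z\<in>elts x. opair \<gamma> z \<in> elts g)"
      using g[of \<beta> x] mem_hier[of x a \<beta>] \<beta> by simp
  qed
  moreover have "\<forall>x\<in>elts (hier a \<alpha>). x \<in> elts a \<or> (\<exists>\<gamma>\<in>elts \<alpha>. \<forall>z\<in>elts x. opair \<gamma> z \<in> elts g)"
    unfolding g using mem_hier[of _ a \<alpha>] by blast
  moreover have "elts a \<subseteq> elts (hier a \<alpha>)"
    unfolding elts_hier[of a \<alpha>] by blast
  moreover have "\<forall>\<gamma>\<in>elts \<alpha>. \<forall>x\<in>elts (vpow (hier a \<alpha>)). (\<forall>z\<in>elts x. opair \<gamma> z \<in> elts g) \<longrightarrow>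
      x \<in> elts (hier a \<alpha>)"
    unfolding g using mem_hier[of _ a \<alpha>] by blast
  ultimately show ?thesis
    unfolding hier_graph_def by blast
qed

lemma hier_graph_unique:
  assumes "ordinal \<alpha>" "hier_graph y a \<alpha>"
  shows "y = hier a \<alpha>"
proof -
  obtain g where g: "elts g \<subseteq> elts (vprod \<alpha> y)"
    and slice: "\<And>\<beta> x. \<beta> \<in> elts \<alpha> \<Longrightarrow> x \<in> elts y \<Longrightarrow> opair \<beta> x \<in> elts g \<longleftrightarrow>
        x \<in> elts a \<or> (\<exists>\<gamma>\<in>elts \<beta>. \<forall>z\<in>elts x. opair \<gamma> z \<in> elts g)"
    and top: "\<And>x. x \<in> elts y \<Longrightarrow> x \<in> elts a \<or> (\<exists>\<gamma>\<in>elts \<alpha>. \<forall>z\<in>elts x. opair \<gamma> z \<in> elts g)"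
    and a: "elts a \<subseteq> elts y"
    and all: "\<And>\<gamma> x. \<gamma> \<in> elts \<alpha> \<Longrightarrow> x \<in> elts (vpow y) \<Longrightarrow> \<forall>z\<in>elts x. opair \<gamma> z \<in> elts g \<Longrightarrow> x \<in> elts y"
    using assms(2) unfolding hier_graph_def by auto
  \<comment> \<open>Membership of \<open>x\<close> in the power set of \<open>y\<close> is
    automatic: each \<open>opair \<gamma> z\<close> in \<open>g\<close> already forces
    \<open>z\<close> into \<open>y\<close>.\<close>
  have all': "x \<in> elts y" if "\<gamma> \<in> elts \<alpha>" "\<forall>z\<in>elts x. opair \<gamma> z \<in> elts g" for \<gamma> x
  proof (rule all[OF that(1) _ that(2)])
    show "x \<in> elts (vpow y)"
      using that(2) g opair_in_vprod by fastforce
  qed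
  have eq: "opair \<beta> x \<in> elts g \<longleftrightarrow> x \<in> elts (hier a \<beta>)" if "\<beta> \<in> elts \<alpha>" for \<beta> x
    using that
  proof (induction \<beta> arbitrary: x rule: elts_induct)
    case (step \<beta>)
    have IH: "(\<forall>z\<in>elts x. opair \<gamma> z \<in> elts g) \<longleftrightarrow> elts x \<subseteq> elts (hier a \<gamma>)" if "\<gamma> \<in> elts \<beta>" for \<gamma> x
      using step.IH[OF that] ordinal_trans[OF assms(1) step.prems that] by auto
    show ?case
    proof
      assume "opair \<beta> x \<in> elts g"
      moreover from this have "x \<in> elts y"
        using g by fastforce
      ultimately show "x \<in> elts (hier a \<beta>)"
        using slice[OF step.prems] IH unfolding mem_hier[of x a \<beta>] by blast
    next
      assume "x \<in> elts (hier a \<beta>)"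
      then have *: "x \<in> elts a \<or> (\<exists>\<gamma>\<in>elts \<beta>. \<forall>z\<in>elts x. opair \<gamma> z \<in> elts g)"
        using IH unfolding mem_hier[of x a \<beta>] by blast
      moreover have "x \<in> elts y"
        using * a all' ordinal_trans[OF assms(1) step.prems] by blast
      ultimately show "opair \<beta> x \<in> elts g"
        using slice[OF step.prems] by blast
    qed
  qed
  have "x \<in> elts y \<longleftrightarrow> x \<in> elts (hier a \<alpha>)" for x
  proof -
    have "(\<forall>z\<in>elts x. opair \<gamma> z \<in> elts g) \<longleftrightarrow> elts x \<subseteq> elts (hier a \<gamma>)" if "\<gamma> \<in> elts \<alpha>" for \<gamma>
      using eq[OF that] by auto
    then show ?thesis
      unfolding mem_hier[of x a \<alpha>] using top[of x] all'[of _ x] a by blast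
  qed
  then show ?thesis
    by (intro extensionality) blast
qed

text \<open>The default makes the function total, as \<open>definable_fun\<close> demands; existence
  and uniqueness of the graph are proved for ordinals.\<close>

definition ord_hier :: "'v::zfc \<Rightarrow> 'v \<Rightarrow> 'v" where
  "ord_hier a \<alpha> = (if ordinal \<alpha> then hier a \<alpha> else emp)"

lemma definable_fun_ord_hier [defn]:
  fixes F G :: "(nat \<Rightarrow> 'v::zfc) \<Rightarrow> 'v"
  assumes "definable_fun F" "definable_fun G"
  shows "definable_fun (\<lambda>e. ord_hier (F e) (G e))"
proof (rule definable_fun_comp2[OF _ _ assms])
  have "definable (\<lambda>e :: nat \<Rightarrow> 'v.
      ordinal (e 2) \<and> hier_graph (e 0) (e 1) (e 2) \<or> \<not> ordinal (e 2) \<and> e 0 = emp)"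
    unfolding hier_graph_def by (intro defn)
  moreover have "ordinal \<alpha> \<and> hier_graph y a \<alpha> \<or> \<not> ordinal \<alpha> \<and> y = emp \<longleftrightarrow> y = ord_hier a \<alpha>"
    for y a \<alpha> :: 'v
    using hier_graph_unique hier_graph_hier by (auto simp: ord_hier_def)
  ultimately show "definable (\<lambda>e :: nat \<Rightarrow> 'v. e 0 = ord_hier (e 1) (e 2))"
    by simp
next
  fix \<mu> x y :: 'v
  assume *: "inaccessible \<mu>" "x \<in> Vuniv \<mu>" "y \<in> Vuniv \<mu>"
  then show "ord_hier x y \<in> Vuniv \<mu>"
    using Vuniv_hier[OF *(1,2), of y] Vuniv_emp[OF *(1)]
      ordinal_in_Vrank[OF inaccessible_ordinal[OF *(1)], of y]
    unfolding ord_hier_def by simp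
qed

section \<open>Definability of inaccessibility\<close>

text \<open>An injection becomes a set \<open>g\<close> of pairs. In the converse direction distinct
  points share no value of \<open>g\<close>, so choosing one value for each point gives an
  injection.\<close>

lemma lepoll_elts_iff:
  "elts a \<lesssim> elts b \<longleftrightarrow> (\<exists>g\<in>elts (vpow (vprod a b)).
     (\<forall>x\<in>elts a. \<exists>y\<in>elts b. opair x y \<in> elts g) \<and>
     (\<forall>x\<in>elts a. \<forall>x'\<in>elts a. \<forall>y\<in>elts b. opair x y \<in> elts g \<and> opair x' y \<in> elts g \<longrightarrow> x = x'))"
  (is "_ \<longleftrightarrow> ?R")
proof
  assume "elts a \<lesssim> elts b"
  then obtain f where f: "inj_on f (elts a)" "f ` elts a \<subseteq> elts b"
    unfolding lepoll_def by blast
  define g where "g = sep (vprod a b) (\<lambda>p. \<exists>x. p = opair x (f x))"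
  have "opair x y \<in> elts g \<longleftrightarrow> x \<in> elts a \<and> y = f x" for x y
    unfolding g_def using f(2) by auto
  moreover have "g \<in> elts (vpow (vprod a b))"
    by (auto simp: g_def)
  ultimately show ?R
    using f by (intro bexI[of _ g]) (auto dest: inj_onD)
next
  assume ?R
  then obtain g where
    g: "\<forall>x\<in>elts a. \<exists>y\<in>elts b. opair x y \<in> elts g"
      "\<forall>x\<in>elts a. \<forall>x'\<in>elts a. \<forall>y\<in>elts b. opair x y \<in> elts g \<and> opair x' y \<in> elts g \<longrightarrow> x = x'"
    by blast
  obtain f where f: "\<forall>x\<in>elts a. f x \<in> elts b \<and> opair x (f x) \<in> elts g"
    using g(1) by metis
  have "inj_on f (elts a)"
    using f g(2) by (intro inj_onI) metis
  then show "elts a \<lesssim> elts b"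
    unfolding lepoll_def using f by blast
qed

lemma definable_lepoll [defn]:
  assumes "definable_fun F" "definable_fun G"
  shows "definable (\<lambda>e. elts (F e) \<lesssim> elts (G e))"
  by (rule definable_comp2[OF _ assms], unfold lepoll_elts_iff) (intro defn)

text \<open>HOL functions are not sets, but on \<open>elts \<alpha>\<close> each is represented by
  its graph, an element of a power set that a universe contains.\<close>

lemma bounded_functions_iff:
  "(\<forall>f. f ` elts \<alpha> \<subseteq> elts \<kappa> \<longrightarrow> (\<exists>\<beta>\<in>elts \<kappa>. \<forall>\<xi>\<in>elts \<alpha>. f \<xi> \<in> elts \<beta>)) \<longleftrightarrow>
   (\<forall>g\<in>elts (vpow (vprod \<alpha> \<kappa>)).
     (\<forall>x\<in>elts \<alpha>. \<exists>y\<in>elts \<kappa>. opair x y \<in> elts g \<and> (\<forall>z\<in>elts \<kappa>. opair x z \<in> elts g \<longrightarrow> z = y)) \<longrightarrow>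
     (\<exists>\<beta>\<in>elts \<kappa>. \<forall>x\<in>elts \<alpha>. \<forall>y\<in>elts \<kappa>. opair x y \<in> elts g \<longrightarrow> y \<in> elts \<beta>))"
  (is "?L \<longleftrightarrow> ?R")
proof
  assume L: ?L
  show ?R
  proof (intro ballI impI)
    fix g
    assume "\<forall>x\<in>elts \<alpha>. \<exists>y\<in>elts \<kappa>. opair x y \<in> elts g \<and> (\<forall>z\<in>elts \<kappa>. opair x z \<in> elts g \<longrightarrow> z = y)"
    then obtain f where f: "\<forall>x\<in>elts \<alpha>. f x \<in> elts \<kappa> \<and> opair x (f x) \<in> elts g \<and>
        (\<forall>z\<in>elts \<kappa>. opair x z \<in> elts g \<longrightarrow> z = f x)"
      by metis
    then obtain \<beta> where "\<beta> \<in> elts \<kappa>" "\<forall>\<xi>\<in>elts \<alpha>. f \<xi> \<in> elts \<beta>"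
      using L[rule_format, of f] by blast
    then show "\<exists>\<beta>\<in>elts \<kappa>. \<forall>x\<in>elts \<alpha>. \<forall>y\<in>elts \<kappa>. opair x y \<in> elts g \<longrightarrow> y \<in> elts \<beta>"
      using f by (intro bexI[of _ \<beta>]) auto
  qed
next
  assume R: ?R
  show ?L
  proof (intro allI impI)
    fix f
    assume f: "f ` elts \<alpha> \<subseteq> elts \<kappa>"
    define g where "g = sep (vprod \<alpha> \<kappa>) (\<lambda>p. \<exists>x. p = opair x (f x))"
    have g: "opair x y \<in> elts g \<longleftrightarrow> x \<in> elts \<alpha> \<and> y = f x" for x y
      unfolding g_def using f by auto
    have "g \<in> elts (vpow (vprod \<alpha> \<kappa>))"
      by (auto simp: g_def)
    moreover have "\<forall>x\<in>elts \<alpha>. \<exists>y\<in>elts \<kappa>. opair x y \<in> elts g \<and> (\<forall>z\<in>elts \<kappa>. opair x z \<in> elts g \<longrightarrow> z = y)"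
      unfolding g using f by auto
    ultimately have "\<exists>\<beta>\<in>elts \<kappa>. \<forall>x\<in>elts \<alpha>. \<forall>y\<in>elts \<kappa>. opair x y \<in> elts g \<longrightarrow> y \<in> elts \<beta>"
      using R by blast
    then show "\<exists>\<beta>\<in>elts \<kappa>. \<forall>\<xi>\<in>elts \<alpha>. f \<xi> \<in> elts \<beta>"
      unfolding g using f by blast
  qed
qed

lemma uncountable_elts_iff: "uncountable (elts \<kappa>) \<longleftrightarrow> \<not> elts \<kappa> \<lesssim> elts (omega :: 'v)"
  for \<kappa> :: "'v::zfc"
proof -
  have omega: "elts (omega :: 'v) \<approx> (UNIV :: nat set)"
    unfolding elts_omega by (rule inj_on_image_eqpoll_self[OF inj_num])
  have "elts \<kappa> \<lesssim> elts (omega :: 'v) \<longleftrightarrow> elts \<kappa> \<lesssim> (UNIV :: nat set)"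
    using lepoll_trans2[OF _ omega] lepoll_trans2[OF _ eqpoll_sym[OF omega]] by blast
  then show ?thesis
    unfolding countable_def lepoll_def by auto
qed

lemma Pow_elts_eqpoll: "Pow (elts \<alpha>) \<approx> elts (vpow \<alpha>)"
proof -
  have "bij_betw elts (elts (vpow \<alpha>)) (Pow (elts \<alpha>))"
    unfolding bij_betw_def using separation by (auto simp: inj_on_def elts_inject image_iff) metis
  then show ?thesis
    using eqpoll_def eqpoll_sym by blast
qed

text \<open>All quantifiers become bounded by sets computed from \<open>\<kappa>\<close>.
  Equipollence is split by Schroeder-Bernstein into two injections.\<close>

lemma inaccessible_iff:
  fixes \<kappa> :: "'v::zfc"
  shows "inaccessible \<kappa> \<longleftrightarrow> ordinal \<kappa> \<and> \<not> elts \<kappa> \<lesssim> elts (omega :: 'v) \<and>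
     (\<forall>\<alpha>\<in>elts \<kappa>. \<not> (elts \<alpha> \<lesssim> elts \<kappa> \<and> elts \<kappa> \<lesssim> elts \<alpha>)) \<and>
     (\<forall>\<alpha>\<in>elts \<kappa>. \<forall>g\<in>elts (vpow (vprod \<alpha> \<kappa>)).
       (\<forall>x\<in>elts \<alpha>. \<exists>y\<in>elts \<kappa>. opair x y \<in> elts g \<and> (\<forall>z\<in>elts \<kappa>. opair x z \<in> elts g \<longrightarrow> z = y)) \<longrightarrow>
       (\<exists>\<beta>\<in>elts \<kappa>. \<forall>x\<in>elts \<alpha>. \<forall>y\<in>elts \<kappa>. opair x y \<in> elts g \<longrightarrow> y \<in> elts \<beta>)) \<and>
     (\<forall>\<alpha>\<in>elts \<kappa>. elts (vpow \<alpha>) \<lesssim> elts \<kappa> \<and> \<not> elts \<kappa> \<lesssim> elts (vpow \<alpha>))"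
proof -
  have eq: "elts a \<approx> elts b \<longleftrightarrow> elts a \<lesssim> elts b \<and> elts b \<lesssim> elts a" for a b :: 'v
    using lepoll_antisym eqpoll_imp_lepoll eqpoll_sym by blast
  have less: "Pow (elts \<alpha>) \<prec> elts \<kappa> \<longleftrightarrow> elts (vpow \<alpha>) \<lesssim> elts \<kappa> \<and> \<not> elts \<kappa> \<lesssim> elts (vpow \<alpha>)"
    for \<alpha> :: 'v
  proof -
    have "Pow (elts \<alpha>) \<prec> elts \<kappa> \<longleftrightarrow> elts (vpow \<alpha>) \<prec> elts \<kappa>"
      using Pow_elts_eqpoll[of \<alpha>] lesspoll_trans1 eqpoll_imp_lepoll eqpoll_sym by metis
    then show ?thesis
      unfolding lesspoll_def eq by blast
  qed
  have inf: "uncountable (elts \<kappa>) \<longrightarrow> infinite (elts \<kappa>)"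
    using countable_finite by blast
  show ?thesis
    unfolding inaccessible_def regular_cardinal_def strong_limit_def cardinal_def
      bounded_functions_iff less eq uncountable_elts_iff[symmetric]
    using inf by argo
qed

lemma definable_inaccessible [defn]:
  assumes "definable_fun F"
  shows "definable (\<lambda>e. inaccessible (F e))"
  by (rule definable_comp1[OF _ assms], unfold inaccessible_iff) (intro defn)

section \<open>Definability of elementary equivalence\<close>

lemma models_All: "models M (All \<phi>) \<longleftrightarrow> models M \<phi>"
proof
  assume L: "models M (All \<phi>)"
  show "models M \<phi>"
    unfolding models_def
  proof (intro allI impI)
    fix e :: "nat \<Rightarrow> 'a"
    assume e: "range e \<subseteq> M"
    then have "range (\<lambda>i. e (Suc i)) \<subseteq> M"
      by blast
    then have "sat M (\<lambda>i. e (Suc i)) (All \<phi>)"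
      using L[unfolded models_def] by simp
    then have "sat M (case_nat (e 0) (\<lambda>i. e (Suc i))) \<phi>"
      using e by auto
    moreover have "case_nat (e 0) (\<lambda>i. e (Suc i)) = e"
      by (auto simp: fun_eq_iff split: nat.split)
    ultimately show "sat M e \<phi>"
      by simp
  qed
next
  assume "models M \<phi>"
  then show "models M (All \<phi>)"
    unfolding models_def by (auto simp: range_case_nat)
qed

text \<open>\<open>models\<close> already quantifies over all environments, so prefixing
  \<open>All\<close> changes nothing, and finitely many prefixes bind every variable.\<close>

lemma ex_universal_closure: "\<exists>\<psi>. sentence \<psi> \<and> (\<forall>M :: 'v::zfc set. models M \<psi> \<longleftrightarrow> models M \<phi>)"
proof -
  have "finite (fv \<phi>)"
    by (induction \<phi>) (auto intro: finite_vimageI[of _ Suc, unfolded vimage_def])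
  then obtain n where "fv \<phi> \<subseteq> {..<n}"
    using finite_nat_iff_bounded by blast
  then show ?thesis
  proof (induction n arbitrary: \<phi>)
    case 0
    then show ?case
      by (auto simp: sentence_def)
  next
    case (Suc n)
    have "fv (All \<phi>) \<subseteq> {..<n}"
      using Suc.prems by auto
    from Suc.IH[OF this] show ?case
      unfolding models_All .
  qed
qed

text \<open>Passing to open formulas is what makes induction on formulas possible when two theories
  are compared.\<close>

lemma fo_theory_eq_iff: "fo_theory M = fo_theory N \<longleftrightarrow> (\<forall>\<phi>. models M \<phi> \<longleftrightarrow> models N \<phi>)"
  for M N :: "'v::zfc set"
proof
  assume *: "fo_theory M = fo_theory N"
  show "\<forall>\<phi>. models M \<phi> \<longleftrightarrow> models N \<phi>"
  proof
    fix \<phi>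
    obtain \<psi> where "sentence \<psi>" "\<forall>M :: 'v set. models M \<psi> \<longleftrightarrow> models M \<phi>"
      using ex_universal_closure by blast
    moreover have "\<psi> \<in> fo_theory M \<longleftrightarrow> \<psi> \<in> fo_theory N"
      using * by simp
    ultimately show "models M \<phi> \<longleftrightarrow> models N \<phi>"
      by (simp add: fo_theory_def)
  qed
qed (simp add: fo_theory_def)

text \<open>The graph of an environment, as a set. Environments are total on the natural numbers, so
  no bookkeeping of free variables is needed.\<close>

definition asg :: "'v::zfc \<Rightarrow> (nat \<Rightarrow> 'v) \<Rightarrow> 'v" where
  "asg m e = sep (vprod omega m) (\<lambda>p. \<exists>n. p = opair (num n) (e n))"

definition assignments :: "'v::zfc \<Rightarrow> 'v" where
  "assignments m = sep (vpow (vprod omega m)) (\<lambda>a. \<forall>n\<in>elts omega. \<exists>x\<in>elts m.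
     opair n x \<in> elts a \<and> (\<forall>y\<in>elts m. opair n y \<in> elts a \<longrightarrow> y = x))"

lemma opair_in_asg [simp]:
  "opair (num n) x \<in> elts (asg m e) \<longleftrightarrow> x = e n \<and> x \<in> elts m"
  by (auto simp: asg_def elts_omega)

lemma asg_inject:
  assumes "range e \<subseteq> elts m" "asg m e = asg m e'"
  shows "e = e'"
proof
  fix n
  have "opair (num n) (e n) \<in> elts (asg m e)"
    using assms(1) by auto
  then show "e n = e' n"
    unfolding assms(2) by simp
qed

lemma elts_assignments: "elts (assignments m) = asg m ` {e. range e \<subseteq> elts m}"
proof (intro set_eqI iffI)
  fix a
  assume "a \<in> elts (assignments m)"
  then have sub: "elts a \<subseteq> elts (vprod omega m)"
    and "\<forall>n. \<exists>x\<in>elts m. opair (num n) x \<in> elts a \<and> (\<forall>y\<in>elts m. opair (num n) y \<in> elts a \<longrightarrow> y = x)"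
    by (auto simp: assignments_def elts_omega)
  then obtain e where e: "\<And>n. e n \<in> elts m" "\<And>n. opair (num n) (e n) \<in> elts a"
    "\<And>n y. y \<in> elts m \<Longrightarrow> opair (num n) y \<in> elts a \<Longrightarrow> y = e n"
    by metis
  have "elts a = elts (asg m e)"
  proof (intro set_eqI iffI)
    fix p
    assume p: "p \<in> elts a"
    then obtain n y where "p = opair (num n) y" "y \<in> elts m"
      using sub by (auto simp: elts_vprod elts_omega)
    then show "p \<in> elts (asg m e)"
      using e p by auto
  next
    fix p
    assume "p \<in> elts (asg m e)"
    then show "p \<in> elts a"
      using e(2) by (auto simp: asg_def)
  qed
  then have "a = asg m e"
    by (rule extensionality)
  then show "a \<in> asg m ` {e. range e \<subseteq> elts m}"
    using e(1) by blast
next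
  fix a
  assume "a \<in> asg m ` {e. range e \<subseteq> elts m}"
  then obtain e where e: "a = asg m e" "range e \<subseteq> elts m"
    by blast
  have "elts a \<subseteq> elts (vprod omega m)"
    by (auto simp: e asg_def)
  then show "a \<in> elts (assignments m)"
    using e(2) by (auto simp: assignments_def elts_omega e(1))
qed

text \<open>The value of a formula in the cylindric set algebra over \<open>m\<close>. Quantifying
  over such values replaces quantifying over codes of formulas.\<close>

definition truth :: "'v::zfc \<Rightarrow> fm \<Rightarrow> 'v" where
  "truth m \<phi> = sep (assignments m) (\<lambda>a. \<exists>e. range e \<subseteq> elts m \<and> a = asg m e \<and> sat (elts m) e \<phi>)"

lemma asg_in_truth: "range e \<subseteq> elts m \<Longrightarrow> asg m e \<in> elts (truth m \<phi>) \<longleftrightarrow> sat (elts m) e \<phi>"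
  using asg_inject[of e m] by (auto simp: truth_def elts_assignments)

lemma truth_eqI:
  assumes "elts X \<subseteq> elts (assignments m)"
    and "\<And>e. range e \<subseteq> elts m \<Longrightarrow> asg m e \<in> elts X \<longleftrightarrow> sat (elts m) e \<phi>"
  shows "truth m \<phi> = X"
proof (rule extensionality, intro set_eqI)
  fix a
  show "a \<in> elts (truth m \<phi>) \<longleftrightarrow> a \<in> elts X"
  proof (cases "a \<in> elts (assignments m)")
    case True
    then show ?thesis
      using assms(2) asg_in_truth[of _ m \<phi>] by (auto simp: elts_assignments)
  next
    case False
    then show ?thesis
      using assms(1) by (auto simp: truth_def)
  qed
qed

text \<open>Validity becomes an equation about the value alone, in which the formula no longer
  occurs.\<close>

lemma truth_eq_assignments_iff: "truth m \<phi> = assignments m \<longleftrightarrow> models (elts m) \<phi>"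
proof
  assume *: "truth m \<phi> = assignments m"
  show "models (elts m) \<phi>"
    unfolding models_def
  proof (intro allI impI)
    fix e :: "nat \<Rightarrow> 'a"
    assume e: "range e \<subseteq> elts m"
    then have "asg m e \<in> elts (truth m \<phi>)"
      unfolding * elts_assignments by blast
    then show "sat (elts m) e \<phi>"
      using asg_in_truth[OF e] by simp
  qed
next
  assume "models (elts m) \<phi>"
  then show "truth m \<phi> = assignments m"
    by (intro truth_eqI) (auto simp: models_def elts_assignments)
qed

section \<open>Set operations corresponding to the connectives\<close>

definition mem_asgs :: "'v::zfc \<Rightarrow> 'v \<Rightarrow> 'v \<Rightarrow> 'v" where
  "mem_asgs m i j = sep (assignments m)
     (\<lambda>a. \<exists>x\<in>elts m. \<exists>y\<in>elts m. opair i x \<in> elts a \<and> opair j y \<in> elts a \<and> x \<in> elts y)"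

definition eq_asgs :: "'v::zfc \<Rightarrow> 'v \<Rightarrow> 'v \<Rightarrow> 'v" where
  "eq_asgs m i j = sep (assignments m)
     (\<lambda>a. \<exists>x\<in>elts m. opair i x \<in> elts a \<and> opair j x \<in> elts a)"

definition compl_asgs :: "'v::zfc \<Rightarrow> 'v \<Rightarrow> 'v" where
  "compl_asgs m X = sep (assignments m) (\<lambda>a. \<not> a \<in> elts X)"

text \<open>The condition on \<open>b\<close> says that its tail is \<open>a\<close>: it arises by
  inserting a new value at index 0, as under a de Bruijn binder.\<close>

definition cyl_asgs :: "'v::zfc \<Rightarrow> 'v \<Rightarrow> 'v" where
  "cyl_asgs m X = sep (assignments m) (\<lambda>a. \<forall>b\<in>elts (assignments m).
     (\<forall>n\<in>elts omega. \<forall>y\<in>elts m. opair n y \<in> elts a \<longrightarrow> opair (vsucc n) y \<in> elts b) \<longrightarrow> b \<in> elts X)"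

lemma truth_Mem: "truth m (Mem i j) = mem_asgs m (num i) (num j)"
  by (rule truth_eqI) (auto simp: mem_asgs_def elts_assignments)

lemma truth_Eq: "truth m (Eq i j) = eq_asgs m (num i) (num j)"
  by (rule truth_eqI) (auto simp: eq_asgs_def elts_assignments)

lemma truth_Neg: "truth m (Neg \<phi>) = compl_asgs m (truth m \<phi>)"
  by (rule truth_eqI) (auto simp: compl_asgs_def asg_in_truth elts_assignments)

lemma truth_And: "truth m (And \<phi> \<psi>) = sep (truth m \<phi>) (\<lambda>a. a \<in> elts (truth m \<psi>))"
  by (rule truth_eqI) (auto simp: asg_in_truth, auto simp: truth_def)

lemma truth_All: "truth m (All \<phi>) = cyl_asgs m (truth m \<phi>)"
proof (rule truth_eqI)
  fix e :: "nat \<Rightarrow> 'a"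
  assume e: "range e \<subseteq> elts m"
  have shift: "(\<forall>n\<in>elts omega. \<forall>y\<in>elts m. opair n y \<in> elts (asg m e) \<longrightarrow>
      opair (vsucc n) y \<in> elts (asg m e')) \<longleftrightarrow> e' = case_nat (e' 0) e"
    (is "?L \<longleftrightarrow> _") for e'
  proof -
    have "?L \<longleftrightarrow> (\<forall>n. opair (num (Suc n)) (e n) \<in> elts (asg m e'))"
      using e by (auto simp: elts_omega simp del: opair_in_asg) (auto simp: range_subsetD)
    also have "\<dots> \<longleftrightarrow> (\<forall>n. e n = e' (Suc n))"
      using e by (auto simp del: num.simps)
    also have "\<dots> \<longleftrightarrow> e' = case_nat (e' 0) e"
      by (auto simp: fun_eq_iff split: nat.splits)
    finally show ?thesis .
  qed
  have "asg m e \<in> elts (cyl_asgs m (truth m \<phi>)) \<longleftrightarrow>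
      (\<forall>e'. range e' \<subseteq> elts m \<longrightarrow> e' = case_nat (e' 0) e \<longrightarrow> asg m e' \<in> elts (truth m \<phi>))"
    using e by (auto simp: cyl_asgs_def elts_assignments shift)
  also have "\<dots> \<longleftrightarrow> (\<forall>e'. range e' \<subseteq> elts m \<longrightarrow> e' = case_nat (e' 0) e \<longrightarrow> sat (elts m) e' \<phi>)"
    by (simp add: asg_in_truth)
  also have "\<dots> \<longleftrightarrow> (\<forall>x\<in>elts m. sat (elts m) (case_nat x e) \<phi>)"
  proof
    assume *: "\<forall>e'. range e' \<subseteq> elts m \<longrightarrow> e' = case_nat (e' 0) e \<longrightarrow> sat (elts m) e' \<phi>"
    show "\<forall>x\<in>elts m. sat (elts m) (case_nat x e) \<phi>"
      using *[rule_format, of "case_nat x e" for x] e by (auto simp: range_case_nat)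
  next
    assume *: "\<forall>x\<in>elts m. sat (elts m) (case_nat x e) \<phi>"
    show "\<forall>e'. range e' \<subseteq> elts m \<longrightarrow> e' = case_nat (e' 0) e \<longrightarrow> sat (elts m) e' \<phi>"
    proof (intro allI impI)
      fix e' :: "nat \<Rightarrow> 'a"
      assume "range e' \<subseteq> elts m" and e': "e' = case_nat (e' 0) e"
      then have "sat (elts m) (case_nat (e' 0) e) \<phi>"
        using * by blast
      then show "sat (elts m) e' \<phi>"
        using e' by simp
    qed
  qed
  finally show "asg m e \<in> elts (cyl_asgs m (truth m \<phi>)) \<longleftrightarrow> sat (elts m) e (All \<phi>)"
    by simp
qed (auto simp: cyl_asgs_def)

text \<open>
  Elementary equivalence without coding formulas as sets: a family of pairs of sets of assignments
  that contains the atomic pairs and is closed under the logical operations contains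
  \<open>(truth a \<phi>, truth b \<phi>)\<close> for every \<open>\<phi>\<close>, and these pairs form such a family.
\<close>

definition elem_equiv :: "'v::zfc \<Rightarrow> 'v \<Rightarrow> bool" where
  "elem_equiv a b \<longleftrightarrow> (\<exists>F\<in>elts (vpow (vprod (vpow (assignments a)) (vpow (assignments b)))).
     (\<forall>i\<in>elts omega. \<forall>j\<in>elts omega.
        opair (mem_asgs a i j) (mem_asgs b i j) \<in> elts F \<and>
        opair (eq_asgs a i j) (eq_asgs b i j) \<in> elts F) \<and>
     (\<forall>X\<in>elts (vpow (assignments a)). \<forall>Y\<in>elts (vpow (assignments b)). opair X Y \<in> elts F \<longrightarrow>
        opair (compl_asgs a X) (compl_asgs b Y) \<in> elts F \<and>
        opair (cyl_asgs a X) (cyl_asgs b Y) \<in> elts F \<and>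
        (X = assignments a \<longleftrightarrow> Y = assignments b) \<and>
        (\<forall>X'\<in>elts (vpow (assignments a)). \<forall>Y'\<in>elts (vpow (assignments b)). opair X' Y' \<in> elts F \<longrightarrow>
           opair (sep X (\<lambda>x. x \<in> elts X')) (sep Y (\<lambda>y. y \<in> elts Y')) \<in> elts F)))"

lemma truth_in_vpow: "truth m \<phi> \<in> elts (vpow (assignments m))"
  by (auto simp: truth_def)

lemma elem_equiv_iff: "elem_equiv a b \<longleftrightarrow> fo_theory (elts a) = fo_theory (elts b)"
proof
  assume "elem_equiv a b"
  then obtain F where
    atom: "\<And>i j. opair (mem_asgs a (num i) (num j)) (mem_asgs b (num i) (num j)) \<in> elts F"
      "\<And>i j. opair (eq_asgs a (num i) (num j)) (eq_asgs b (num i) (num j)) \<in> elts F"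
    and clos: "\<forall>X\<in>elts (vpow (assignments a)). \<forall>Y\<in>elts (vpow (assignments b)). opair X Y \<in> elts F \<longrightarrow>
        opair (compl_asgs a X) (compl_asgs b Y) \<in> elts F \<and>
        opair (cyl_asgs a X) (cyl_asgs b Y) \<in> elts F \<and>
        (X = assignments a \<longleftrightarrow> Y = assignments b) \<and>
        (\<forall>X'\<in>elts (vpow (assignments a)). \<forall>Y'\<in>elts (vpow (assignments b)). opair X' Y' \<in> elts F \<longrightarrow>
           opair (sep X (\<lambda>x. x \<in> elts X')) (sep Y (\<lambda>y. y \<in> elts Y')) \<in> elts F)"
    unfolding elem_equiv_def elts_omega by blast
  note clos = clos[rule_format, OF truth_in_vpow truth_in_vpow]
  have "opair (truth a \<phi>) (truth b \<phi>) \<in> elts F" for \<phi>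
  proof (induction \<phi>)
    case (And \<phi> \<psi>)
    then show ?case
      using clos[OF And.IH(1)] truth_in_vpow unfolding truth_And by blast
  qed (simp_all add: truth_Mem truth_Eq truth_Neg truth_All atom clos)
  then have "models (elts a) \<phi> \<longleftrightarrow> models (elts b) \<phi>" for \<phi>
    using clos unfolding truth_eq_assignments_iff[symmetric] by blast
  then show "fo_theory (elts a) = fo_theory (elts b)"
    unfolding fo_theory_eq_iff by blast
next
  assume "fo_theory (elts a) = fo_theory (elts b)"
  then have eq: "truth a \<phi> = assignments a \<longleftrightarrow> truth b \<phi> = assignments b" for \<phi>
    unfolding truth_eq_assignments_iff fo_theory_eq_iff by blast
  \<comment> \<open>One \<open>\<phi>\<close> supplies both components of a pair, so the closure
    clauses follow from the equations for \<open>truth\<close>, and \<open>eq\<close> gives the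
    clause about validity.\<close>
  define F where "F = sep (vprod (vpow (assignments a)) (vpow (assignments b)))
    (\<lambda>p. \<exists>\<phi>. p = opair (truth a \<phi>) (truth b \<phi>))"
  have F: "opair X Y \<in> elts F \<longleftrightarrow> (\<exists>\<phi>. X = truth a \<phi> \<and> Y = truth b \<phi>)" for X Y
    unfolding F_def using truth_in_vpow[of a] truth_in_vpow[of b] by auto
  have "F \<in> elts (vpow (vprod (vpow (assignments a)) (vpow (assignments b))))"
    unfolding F_def elts_vpow by auto
  moreover have "\<forall>i\<in>elts omega. \<forall>j\<in>elts omega.
        opair (mem_asgs a i j) (mem_asgs b i j) \<in> elts F \<and>
        opair (eq_asgs a i j) (eq_asgs b i j) \<in> elts F"
    unfolding F elts_omega by (auto simp: truth_Mem[symmetric] truth_Eq[symmetric])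
  moreover have "opair (compl_asgs a X) (compl_asgs b Y) \<in> elts F \<and>
        opair (cyl_asgs a X) (cyl_asgs b Y) \<in> elts F \<and>
        (X = assignments a \<longleftrightarrow> Y = assignments b) \<and>
        (\<forall>X'\<in>elts (vpow (assignments a)). \<forall>Y'\<in>elts (vpow (assignments b)). opair X' Y' \<in> elts F \<longrightarrow>
           opair (sep X (\<lambda>x. x \<in> elts X')) (sep Y (\<lambda>y. y \<in> elts Y')) \<in> elts F)"
    if XY: "opair X Y \<in> elts F" for X Y
  proof -
    obtain \<phi> where \<phi>: "X = truth a \<phi>" "Y = truth b \<phi>"
      using XY F by blast
    show ?thesis
      unfolding F \<phi> eq
      by (auto simp: truth_Neg[symmetric] truth_All[symmetric] truth_And[symmetric] simp del: elts_vpow)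
  qed
  ultimately show "elem_equiv a b"
    unfolding elem_equiv_def by blast
qed

text \<open>This turns freshness into a single formula, where sentence-by-sentence comparison would
  give an infinite schema.\<close>

lemma definable_same_theory:
  assumes "definable_fun F" "definable_fun G"
  shows "definable (\<lambda>e. fo_theory (elts (F e)) = fo_theory (elts (G e)))"
proof (rule definable_comp2[OF _ assms])
  show "definable (\<lambda>e :: nat \<Rightarrow> 'a. fo_theory (elts (e 0)) = fo_theory (elts (e 1)))"
    unfolding elem_equiv_iff[symmetric] elem_equiv_def assignments_def mem_asgs_def eq_asgs_def
      compl_asgs_def cyl_asgs_def
    by (intro defn)
qed

text \<open>With \<open>\<phi>\<close> fixed in advance, induction relativises its quantifiers to
  the set at index 0. Under a quantifier this set moves to index 1, and the renaming exchanges it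
  with the bound variable.\<close>

lemma definable_sat: "definable (\<lambda>e :: nat \<Rightarrow> 'v::zfc. sat (elts (e 0)) (\<lambda>i. e (Suc i)) \<phi>)"
proof (induction \<phi>)
  case (All \<phi>)
  have "definable (\<lambda>e :: nat \<Rightarrow> 'v. sat (elts (e 1)) (case_nat (e 0) (\<lambda>i. e (Suc (Suc i)))) \<phi>)"
  proof (rule definable_cong)
    show "definable (\<lambda>e :: nat \<Rightarrow> 'v. sat (elts (e 1))
        (\<lambda>i. e (case_nat 1 (case_nat 0 (\<lambda>i. Suc (Suc i))) (Suc i))) \<phi>)"
      using definable_rename[OF All, of "case_nat 1 (case_nat 0 (\<lambda>i. Suc (Suc i)))"] by simp
  next
    fix e :: "nat \<Rightarrow> 'v"
    have "(\<lambda>i. e (case_nat 1 (case_nat 0 (\<lambda>i. Suc (Suc i))) (Suc i))) =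
        case_nat (e 0) (\<lambda>i. e (Suc (Suc i)))"
      by (auto simp: fun_eq_iff split: nat.split)
    then show "sat (elts (e 1)) (\<lambda>i. e (case_nat 1 (case_nat 0 (\<lambda>i. Suc (Suc i))) (Suc i))) \<phi> \<longleftrightarrow>
        sat (elts (e 1)) (case_nat (e 0) (\<lambda>i. e (Suc (Suc i)))) \<phi>"
      by simp
  qed
  then have "definable (\<lambda>e :: nat \<Rightarrow> 'v. \<forall>x\<in>elts (e 0). sat (elts (e 0)) (case_nat x (\<lambda>i. e (Suc i))) \<phi>)"
    by (intro definable_ball defn) simp
  then show ?case
    by simp
qed (simp_all add: defn)

lemma sat_sentence: "sentence \<phi> \<Longrightarrow> sat M e \<phi> \<longleftrightarrow> sat M e' \<phi>"
  unfolding sentence_def by (rule sat_cong) simp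

text \<open>An empty structure has no environments and satisfies everything; otherwise any
  \<open>e\<close>, even one with values outside \<open>M\<close>, decides a sentence.\<close>

lemma models_sentence:
  assumes "sentence \<phi>"
  shows "models M \<phi> \<longleftrightarrow> M = {} \<or> sat M e \<phi>"
proof (cases "M = {}")
  case False
  then obtain x where "x \<in> M"
    by blast
  then have "range (\<lambda>_ :: nat. x) \<subseteq> M"
    by blast
  then show ?thesis
    using False sat_sentence[OF assms] unfolding models_def by blast
qed (auto simp: models_def)

lemma definable_models:
  assumes "sentence \<phi>" "definable_fun F"
  shows "definable (\<lambda>e. models (elts (F e)) \<phi>)"
proof (rule definable_comp1[OF _ assms(2)])
  have "definable (\<lambda>e :: nat \<Rightarrow> 'a. (\<forall>x\<in>elts (e 0). \<not> x = x) \<or> sat (elts (e 0)) (\<lambda>i. e (Suc i)) \<phi>)"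
    by (intro defn definable_sat)
  then show "definable (\<lambda>e :: nat \<Rightarrow> 'a. models (elts (e 0)) \<phi>)"
    by (rule definable_cong) (use models_sentence[OF assms(1)] in auto)
qed

section \<open>Second-order theories\<close>

text \<open>
  Second-order logic over a transitive set \<open>m\<close> is first-order logic over its power set, in which
  the members of \<open>m\<close> are the elements that belong to something. First-order variables get even
  indices, second-order variables odd ones.
\<close>

definition join :: "(nat \<Rightarrow> 'v) \<Rightarrow> (nat \<Rightarrow> 'v) \<Rightarrow> nat \<Rightarrow> 'v" where
  "join e E n = (if even n then e (n div 2) else E (n div 2))"

text \<open>Index 0 is the bound variable. An older first-order variable moves down by two slots and
  up by one for the binder; second-order variables only feel the binder.\<close>

definition bind1 :: "nat \<Rightarrow> nat" where
  "bind1 n = (if n = 0 then 0 else if even n then n - 1 else Suc n)"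

text \<open>The roles are exchanged: slot 1 holds the newly bound second-order variable, and the
  later odd slots move down.\<close>

definition bind2 :: "nat \<Rightarrow> nat" where
  "bind2 n = (if n = 1 then 0 else if even n then Suc n else n - 1)"

lemma join_case_nat1: "(\<lambda>n. case_nat x (join e E) (bind1 n)) = join (case_nat x e) E"
proof
  fix n
  consider "n = 0" | i where "n = Suc (Suc (2 * i))" | j where "n = Suc (2 * j)"
    by (metis oddE evenE Suc_eq_plus1 add_2_eq_Suc' mult_Suc_right not0_implies_Suc mult_0_right add.commute)
  then show "case_nat x (join e E) (bind1 n) = join (case_nat x e) E n"
    by cases (auto simp: join_def bind1_def)
qed

lemma join_case_nat2: "(\<lambda>n. case_nat x (join e E) (bind2 n)) = join e (case_nat x E)"
proof
  fix n
  consider "n = 1" | i where "n = 2 * i" | j where "n = Suc (Suc (Suc (2 * j)))"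
    by (metis oddE evenE Suc_eq_plus1 add_2_eq_Suc' mult_Suc_right not0_implies_Suc mult_0_right add.commute One_nat_def)
  then show "case_nat x (join e E) (bind2 n) = join e (case_nat x E) n"
    by cases (auto simp: join_def bind2_def)
qed

text \<open>The guard in the clause for \<open>SAll1\<close> says that the quantified element, index
  1 under the inner binder, belongs to something.\<close>

primrec tr :: "sfm \<Rightarrow> fm" where
  "tr (SMem i j) = Mem (2 * i) (2 * j)"
| "tr (SEq i j) = Eq (2 * i) (2 * j)"
| "tr (SIn i j) = Mem (2 * i) (Suc (2 * j))"
| "tr (SNeg \<phi>) = Neg (tr \<phi>)"
| "tr (SAnd \<phi> \<psi>) = And (tr \<phi>) (tr \<psi>)"
| "tr (SAll1 \<phi>) = All (Neg (And (Neg (All (Neg (Mem 1 0)))) (Neg (ren bind1 (tr \<phi>)))))"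
| "tr (SAll2 \<phi>) = All (ren bind2 (tr \<phi>))"

lemma fv_tr: "fv (tr \<phi>) \<subseteq> (\<lambda>i. 2 * i) ` sfv1 \<phi> \<union> (\<lambda>j. Suc (2 * j)) ` sfv2 \<phi>"
proof (induction \<phi>)
  case (SAll1 \<phi>)
  show ?case
  proof
    fix i
    assume "i \<in> fv (tr (SAll1 \<phi>))"
    then have "Suc i \<in> bind1 ` fv (tr \<phi>)"
      using fv_ren[of bind1 "tr \<phi>"] by auto
    then obtain n where fv: "n \<in> fv (tr \<phi>)" and n: "Suc i = bind1 n"
      by blast
    have "n \<in> (\<lambda>i. 2 * i) ` sfv1 \<phi> \<union> (\<lambda>j. Suc (2 * j)) ` sfv2 \<phi>"
      by (rule subsetD[OF SAll1 fv])
    with n consider k where "k \<in> sfv1 \<phi>" "Suc i = bind1 (2 * k)"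
      | j where "j \<in> sfv2 \<phi>" "Suc i = bind1 (Suc (2 * j))"
      by blast
    then show "i \<in> (\<lambda>i. 2 * i) ` sfv1 (SAll1 \<phi>) \<union> (\<lambda>j. Suc (2 * j)) ` sfv2 (SAll1 \<phi>)"
    proof cases
      case 1
      then show ?thesis
        by (cases k) (auto simp: bind1_def)
    qed (auto simp: bind1_def)
  qed
next
  case (SAll2 \<phi>)
  show ?case
  proof
    fix i
    assume "i \<in> fv (tr (SAll2 \<phi>))"
    then have "Suc i \<in> bind2 ` fv (tr \<phi>)"
      using fv_ren[of bind2 "tr \<phi>"] by auto
    then obtain n where fv: "n \<in> fv (tr \<phi>)" and n: "Suc i = bind2 n"
      by blast
    have "n \<in> (\<lambda>i. 2 * i) ` sfv1 \<phi> \<union> (\<lambda>j. Suc (2 * j)) ` sfv2 \<phi>"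
      by (rule subsetD[OF SAll2 fv])
    with n consider k where "k \<in> sfv1 \<phi>" "Suc i = bind2 (2 * k)"
      | j where "j \<in> sfv2 \<phi>" "Suc i = bind2 (Suc (2 * j))"
      by blast
    then show "i \<in> (\<lambda>i. 2 * i) ` sfv1 (SAll2 \<phi>) \<union> (\<lambda>j. Suc (2 * j)) ` sfv2 (SAll2 \<phi>)"
    proof cases
      case 2
      then show ?thesis
        by (cases j) (auto simp: bind2_def)
    qed (auto simp: bind2_def)
  qed
qed auto

text \<open>Transitivity makes each member of \<open>m\<close> also a member of
  \<open>vpow m\<close>, so both sorts of values live there. By separation every HOL subset of
  \<open>m\<close> is the extension of an element of \<open>vpow m\<close>.\<close>

lemma sat_tr:
  assumes m: "transitive_set m"
    and "range e \<subseteq> elts m" "range E \<subseteq> elts (vpow m)"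
  shows "sat (elts (vpow m)) (join e E) (tr \<phi>) \<longleftrightarrow> ssat (elts m) e (\<lambda>j. elts (E j)) \<phi>"
  using assms(2,3)
proof (induction \<phi> arbitrary: e E)
  case (SAll1 \<phi>)
  have mem: "x \<in> elts m \<longleftrightarrow> x \<in> elts (vpow m) \<and> (\<exists>y\<in>elts (vpow m). x \<in> elts y)" for x
    using m unfolding transitive_set_def by auto
  have "sat (elts (vpow m)) (join e E) (tr (SAll1 \<phi>)) \<longleftrightarrow>
      (\<forall>x\<in>elts m. sat (elts (vpow m)) (join (case_nat x e) E) (tr \<phi>))"
    by (auto simp: sat_ren join_case_nat1 mem simp del: elts_vpow) blast
  also have "\<dots> \<longleftrightarrow> (\<forall>x\<in>elts m. ssat (elts m) (case_nat x e) (\<lambda>j. elts (E j)) \<phi>)"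
    using SAll1.prems by (intro ball_cong refl SAll1.IH) (auto simp: range_case_nat)
  finally show ?case
    by simp
next
  case (SAll2 \<phi>)
  have case_elts: "(\<lambda>j. elts (case_nat X E j)) = case_nat (elts X) (\<lambda>j. elts (E j))" for X
    by (auto simp: fun_eq_iff split: nat.split)
  have "sat (elts (vpow m)) (join e E) (tr (SAll2 \<phi>)) \<longleftrightarrow>
      (\<forall>X\<in>elts (vpow m). sat (elts (vpow m)) (join e (case_nat X E)) (tr \<phi>))"
    by (simp add: sat_ren join_case_nat2 del: elts_vpow)
  also have "\<dots> \<longleftrightarrow> (\<forall>X\<in>elts (vpow m). ssat (elts m) e (\<lambda>j. elts (case_nat X E j)) \<phi>)"
    using SAll2.prems by (intro ball_cong refl SAll2.IH) (auto simp: range_case_nat)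
  also have "\<dots> \<longleftrightarrow> (\<forall>X. X \<subseteq> elts m \<longrightarrow> ssat (elts m) e (case_nat X (\<lambda>j. elts (E j))) \<phi>)"
    unfolding case_elts
  proof
    assume *: "\<forall>X\<in>elts (vpow m). ssat (elts m) e (case_nat (elts X) (\<lambda>j. elts (E j))) \<phi>"
    show "\<forall>X. X \<subseteq> elts m \<longrightarrow> ssat (elts m) e (case_nat X (\<lambda>j. elts (E j))) \<phi>"
    proof (intro allI impI)
      fix X
      assume "X \<subseteq> elts m"
      moreover from this obtain x where "elts x = X"
        using separation by blast
      ultimately show "ssat (elts m) e (case_nat X (\<lambda>j. elts (E j))) \<phi>"
        using *[rule_format, of x] by simp
    qed
  qed simp
  finally show ?case
    by simp
qed (auto simp: join_def)

lemma tr_in_fo_theory_iff: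
  assumes m: "transitive_set m" "elts m \<noteq> {}" and \<phi>: "sfv1 \<phi> = {}" "sfv2 \<phi> = {}"
  shows "tr \<phi> \<in> fo_theory (elts (vpow m)) \<longleftrightarrow> \<phi> \<in> so_theory (elts m)"
proof -
  have sent: "sentence (tr \<phi>)"
    using fv_tr[of \<phi>] \<phi> by (auto simp: sentence_def)
  have ne: "elts (vpow m) \<noteq> {}"
    by auto
  show ?thesis
  proof
    assume L: "tr \<phi> \<in> fo_theory (elts (vpow m))"
    have "ssat (elts m) e E \<phi>" if eE: "range e \<subseteq> elts m" "range E \<subseteq> Pow (elts m)" for e E
    proof -
      have "\<exists>x. elts x = E j" for j
        using separation eE(2) by blast
      then obtain E' where E': "\<And>j. elts (E' j) = E j"
        by metis
      then have "range E' \<subseteq> elts (vpow m)"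
        using eE(2) by auto
      then have "ssat (elts m) e (\<lambda>j. elts (E' j)) \<phi>"
        using sat_tr[OF m(1) eE(1), of E' \<phi>] L ne
          models_sentence[OF sent, of "elts (vpow m)" "join e E'"]
        by (simp add: fo_theory_def del: elts_vpow)
      then show ?thesis
        by (simp add: E')
    qed
    then show "\<phi> \<in> so_theory (elts m)"
      using \<phi> by (simp add: so_theory_def)
  next
    assume R: "\<phi> \<in> so_theory (elts m)"
    obtain x where x: "x \<in> elts m"
      using m(2) by blast
    \<comment> \<open>Any environment will do for a sentence; nonemptiness of \<open>m\<close>
      guarantees that one exists.\<close>
    have "ssat (elts m) (\<lambda>_. x) (\<lambda>_. elts m) \<phi>"
      using R x by (auto simp: so_theory_def)
    then have "sat (elts (vpow m)) (join (\<lambda>_. x) (\<lambda>_. m)) (tr \<phi>)"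
      using sat_tr[OF m(1), of "\<lambda>_. x" "\<lambda>_. m" \<phi>] x by auto
    then show "tr \<phi> \<in> fo_theory (elts (vpow m))"
      using models_sentence[OF sent] sent by (auto simp: fo_theory_def simp del: elts_vpow)
  qed
qed

text \<open>The first-order theory of the power set determines the second-order theory;
  \<open>fresh_mono\<close> then carries freshness from the latter to the former.\<close>

lemma so_theory_eqI:
  assumes "transitive_set m" "elts m \<noteq> {}" "transitive_set n" "elts n \<noteq> {}"
    and eq: "fo_theory (elts (vpow m)) = fo_theory (elts (vpow n))"
  shows "so_theory (elts m) = so_theory (elts n)"
proof (rule set_eqI)
  fix \<phi>
  show "\<phi> \<in> so_theory (elts m) \<longleftrightarrow> \<phi> \<in> so_theory (elts n)"
  proof (cases "sfv1 \<phi> = {} \<and> sfv2 \<phi> = {}")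
    case True
    then show ?thesis
      using tr_in_fo_theory_iff[OF assms(1,2), of \<phi>] tr_in_fo_theory_iff[OF assms(3,4), of \<phi>] eq
      by simp
  qed (auto simp: so_theory_def)
qed

section \<open>Categoricity of the next inaccessible\<close>

text \<open>\<open>Q\<close> and \<open>R\<close> are absolute, but the two displayed quantifiers
  range over the universe itself and see its height. The combined statement is therefore not
  \<open>definable\<close> and gets its own formula.\<close>

lemma ex_all_transfer:
  fixes \<mu> \<nu> :: "'v::zfc"
  assumes Q: "definable (\<lambda>e :: nat \<Rightarrow> 'v. Q (e 0))" and R: "definable (\<lambda>e :: nat \<Rightarrow> 'v. R (e 0) (e 1))"
    and \<nu>: "inaccessible \<nu>" and \<mu>: "inaccessible \<mu>"
    and Th: "\<forall>\<phi>\<in>first_order_theory \<nu>. models (Vuniv \<mu>) \<phi>"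
    and ex: "\<exists>x\<in>Vuniv \<nu>. Q x \<and> (\<forall>y\<in>Vuniv \<nu>. R x y)"
  shows "\<exists>x\<in>Vuniv \<mu>. Q x \<and> (\<forall>y\<in>Vuniv \<mu>. R x y)"
proof -
  obtain \<phi> where \<phi>:
    "\<And>\<mu> e. inaccessible \<mu> \<Longrightarrow> range e \<subseteq> Vuniv \<mu> \<Longrightarrow> sat (Vuniv \<mu>) e \<phi> \<longleftrightarrow> Q (e 0)"
    using Q unfolding definable_def by blast
  \<comment> \<open>The variable \<open>y\<close> is bound innermost, hence index 0, and
    \<open>x\<close> becomes index 1.\<close>
  have "definable (\<lambda>e :: nat \<Rightarrow> 'v. R (e 1) (e 0))"
    using definable_rename[OF R, of "case_nat 1 (\<lambda>_. 0)"] by simp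
  then obtain \<psi> where \<psi>:
    "\<And>\<mu> e. inaccessible \<mu> \<Longrightarrow> range e \<subseteq> Vuniv \<mu> \<Longrightarrow> sat (Vuniv \<mu>) e \<psi> \<longleftrightarrow> R (e 1) (e 0)"
    unfolding definable_def by blast
  define \<chi> where "\<chi> = Neg (All (Neg (And \<phi> (All \<psi>))))"
  have sat: "sat (Vuniv \<mu>) e \<chi> \<longleftrightarrow> (\<exists>x\<in>Vuniv \<mu>. Q x \<and> (\<forall>y\<in>Vuniv \<mu>. R x y))"
    if "inaccessible \<mu>" "range e \<subseteq> Vuniv \<mu>" for \<mu> e
    using that by (auto simp: \<chi>_def \<phi> \<psi> range_case_nat)
  have models: "models (Vuniv \<mu>) \<chi> \<longleftrightarrow> (\<exists>x\<in>Vuniv \<mu>. Q x \<and> (\<forall>y\<in>Vuniv \<mu>. R x y))"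
    if \<mu>: "inaccessible \<mu>" for \<mu>
  proof -
    have "range (\<lambda>_ :: nat. emp) \<subseteq> Vuniv \<mu>"
      using Vuniv_emp[OF \<mu>] by auto
    then show ?thesis
      unfolding models_def using sat[OF \<mu>] by metis
  qed
  \<comment> \<open>Definability does not control free variables, so \<open>\<chi>\<close> is closed
    up to obtain a member of the theory.\<close>
  obtain \<sigma> where \<sigma>: "sentence \<sigma>" "\<forall>M :: 'v set. models M \<sigma> \<longleftrightarrow> models M \<chi>"
    using ex_universal_closure by blast
  have "\<sigma> \<in> first_order_theory \<nu>"
    using \<sigma> models[OF \<nu>] ex by (simp add: first_order_theory_def fo_theory_def)
  then show ?thesis
    using Th \<sigma>(2) models[OF \<mu>] by blast
qed

lemma next_inaccessible_iff:
  assumes "inaccessible \<nu>" "inaccessible \<kappa>"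
  shows "next_inaccessible \<kappa> \<nu> \<longleftrightarrow>
    \<kappa> \<in> Vuniv \<nu> \<and> (\<forall>y\<in>Vuniv \<nu>. inaccessible y \<longrightarrow> \<not> \<kappa> \<in> elts y)"
  using assms ordinal_in_Vrank[of \<nu>] inaccessible_ordinal unfolding next_inaccessible_def by blast

text \<open>The larger of two distinct candidates would lie strictly between the smaller one and
  \<open>\<mu>\<close>.\<close>

lemma next_inaccessible_unique_below:
  assumes "inaccessible \<kappa>" "inaccessible \<rho>" "next_inaccessible \<kappa> \<mu>" "next_inaccessible \<rho> \<mu>"
  shows "\<kappa> = \<rho>"
  using assms ordinal_linear[of \<kappa> \<rho>] inaccessible_ordinal unfolding next_inaccessible_def by blast

lemma next_inaccessible_unique_above:
  assumes "next_inaccessible \<kappa> \<mu>" "next_inaccessible \<kappa> \<nu>"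
  shows "\<mu> = \<nu>"
  using assms ordinal_linear[of \<mu> \<nu>] inaccessible_ordinal unfolding next_inaccessible_def by blast

text \<open>\<open>F\<close> abstracts from the order of the theory: it sends a cardinal to the
  structure whose first-order theory is considered.\<close>

theorem fresh_definable_next_categorical:
  fixes F :: "'v::zfc \<Rightarrow> 'v"
  assumes F: "definable_fun (\<lambda>e. F (e 0))"
    and fresh: "fresh (\<lambda>\<kappa>. fo_theory (elts (F \<kappa>))) \<kappa>"
    and nxt: "next_inaccessible \<kappa> \<nu>"
  shows "fo_theory_categorical \<nu>"
proof -
  let ?Th = "\<lambda>\<kappa>. fo_theory (elts (F \<kappa>))"
  have \<nu>: "inaccessible \<nu>" and \<kappa>: "inaccessible \<kappa>"
    using nxt fresh by (auto simp: next_inaccessible_def fresh_def)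
  have Fn: "definable_fun (\<lambda>e. F (e n))" for n
    using definable_fun_rename[OF F, of "\<lambda>_. n"] by simp
  have transfer: "\<exists>\<rho>. next_inaccessible \<rho> \<mu> \<and> inaccessible \<rho> \<and> Q \<rho>"
    if \<mu>: "inaccessible \<mu>" and Th: "\<forall>\<phi>\<in>first_order_theory \<nu>. models (Vuniv \<mu>) \<phi>"
      and Q: "definable (\<lambda>e :: nat \<Rightarrow> 'v. Q (e 0))" and "Q \<kappa>" for \<mu> Q
  proof -
    have "\<exists>x\<in>Vuniv \<mu>. (inaccessible x \<and> Q x) \<and> (\<forall>y\<in>Vuniv \<mu>. inaccessible y \<longrightarrow> \<not> x \<in> elts y)"
    proof (rule ex_all_transfer[OF _ _ \<nu> \<mu> Th])
      show "\<exists>x\<in>Vuniv \<nu>. (inaccessible x \<and> Q x) \<and> (\<forall>y\<in>Vuniv \<nu>. inaccessible y \<longrightarrow> \<not> x \<in> elts y)"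
        using nxt \<open>Q \<kappa>\<close> \<kappa> unfolding next_inaccessible_iff[OF \<nu> \<kappa>] by blast
    qed (intro defn Q)+
    then show ?thesis
      using next_inaccessible_iff[OF \<mu>] by blast
  qed
  have "\<mu> = \<nu>" if \<mu>: "inaccessible \<mu>" and Th: "\<forall>\<phi>\<in>first_order_theory \<nu>. models (Vuniv \<mu>) \<phi>" for \<mu>
  proof -
    have "definable (\<lambda>e :: nat \<Rightarrow> 'v. \<forall>\<delta>\<in>elts (e 0). inaccessible \<delta> \<longrightarrow> \<not> ?Th (e 0) = ?Th \<delta>)"
      by (intro defn definable_same_theory Fn)
    moreover have "\<forall>\<delta>\<in>elts \<kappa>. inaccessible \<delta> \<longrightarrow> \<not> ?Th \<kappa> = ?Th \<delta>"
      using fresh unfolding fresh_def by blast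
    ultimately obtain \<rho> where \<rho>: "next_inaccessible \<rho> \<mu>" "inaccessible \<rho>"
      and fresh': "\<forall>\<delta>\<in>elts \<rho>. inaccessible \<delta> \<longrightarrow> \<not> ?Th \<rho> = ?Th \<delta>"
      using transfer[OF \<mu> Th, of "\<lambda>x. \<forall>\<delta>\<in>elts x. inaccessible \<delta> \<longrightarrow> \<not> ?Th x = ?Th \<delta>"] by blast
    have "models (elts (F \<rho>)) \<phi> \<longleftrightarrow> models (elts (F \<kappa>)) \<phi>" if "sentence \<phi>" for \<phi>
    proof -
      \<comment> \<open>Each application of \<open>transfer\<close> yields its own witness;
        uniqueness of the inaccessible just below \<open>\<mu>\<close> identifies it with
        \<open>\<rho>\<close>.\<close>
      have *: "Q \<rho>" if "definable (\<lambda>e :: nat \<Rightarrow> 'v. Q (e 0))" "Q \<kappa>" for Q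
        using transfer[OF \<mu> Th that] next_inaccessible_unique_below[OF \<rho>(2) _ \<rho>(1)] by blast
      have "definable (\<lambda>e :: nat \<Rightarrow> 'v. models (elts (F (e 0))) \<phi>)"
        by (rule definable_models[OF that Fn])
      \<comment> \<open>Transfer goes one way only, so it is applied to the property and to its
        negation.\<close>
      then show ?thesis
        using *[of "\<lambda>x. models (elts (F x)) \<phi>"] *[of "\<lambda>x. \<not> models (elts (F x)) \<phi>"] definable_not
        by blast
    qed
    then have "?Th \<kappa> = ?Th \<rho>"
      unfolding fo_theory_def by blast
    then have "\<rho> = \<kappa>"
      using ordinal_linear[OF inaccessible_ordinal[OF \<rho>(2)] inaccessible_ordinal[OF \<kappa>]]
        fresh fresh' \<kappa> \<rho>(2) unfolding fresh_def by metis
    then show "\<mu> = \<nu>"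
      using \<rho>(1) nxt next_inaccessible_unique_above by blast
  qed
  then show ?thesis
    unfolding fo_theory_categorical_def using \<nu>
    by (intro conjI exI[of _ "first_order_theory \<nu>"])
      (auto simp: first_order_theory_def fo_theory_def)
qed

text \<open>Freshness passes to any assignment \<open>Th'\<close> fine enough to separate whatever
  \<open>Th\<close> separates from \<open>\<kappa>\<close>.\<close>

lemma fresh_mono:
  assumes "fresh Th \<kappa>"
    and "\<And>\<delta>. inaccessible \<delta> \<Longrightarrow> inaccessible \<kappa> \<Longrightarrow> Th' \<kappa> = Th' \<delta> \<Longrightarrow> Th \<kappa> = Th \<delta>"
  shows "fresh Th' \<kappa>"
  using assms unfolding fresh_def by blast

text \<open>Sentences carry no parameters, so \<open>\<alpha>\<close> may enter only through a
  definition that is correct in every universe.\<close>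

lemma definable_fun_absolutely_definable:
  assumes "absolutely_definable \<alpha>"
  shows "definable_fun (\<lambda>e. \<alpha>)"
proof -
  obtain \<psi> where \<psi>: "fv \<psi> \<subseteq> {0}" "\<And>\<mu>. inaccessible \<mu> \<Longrightarrow> \<alpha> \<in> Vuniv \<mu>"
    "\<And>\<mu> x. inaccessible \<mu> \<Longrightarrow> x \<in> Vuniv \<mu> \<Longrightarrow> sat (Vuniv \<mu>) (\<lambda>_. x) \<psi> \<longleftrightarrow> x = \<alpha>"
    using assms unfolding absolutely_definable_def by blast
  show ?thesis
  proof (rule definable_funI)
    show "definable (\<lambda>e. e 0 = \<alpha>)"
    proof (rule definableI[of \<psi>])
      fix \<mu> :: 'a and e :: "nat \<Rightarrow> 'a"
      assume *: "inaccessible \<mu>" "range e \<subseteq> Vuniv \<mu>"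
      have "sat (Vuniv \<mu>) e \<psi> \<longleftrightarrow> sat (Vuniv \<mu>) (\<lambda>_. e 0) \<psi>"
        using \<psi>(1) by (intro sat_cong) auto
      then show "sat (Vuniv \<mu>) e \<psi> \<longleftrightarrow> e 0 = \<alpha>"
        using \<psi>(3)[OF *(1), of "e 0"] *(2) by auto
    qed
  qed (rule \<psi>(2))
qed

theorem theorem8:
  fixes \<kappa> \<nu> :: "'v::zfc"
  assumes "inaccessible \<kappa>"
    and "fresh first_order_theory \<kappa> \<or> fresh second_order_theory \<kappa> \<or>
         (\<exists>\<alpha>. absolutely_definable \<alpha> \<and> fresh (alpha_order_theory \<alpha>) \<kappa>)"
    and "next_inaccessible \<kappa> \<nu>"
  shows "fo_theory_categorical \<nu>"
proof -
  have V: "ord_hier emp \<mu> = Vrank \<mu>" if "inaccessible \<mu>" for \<mu> :: 'v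
    using inaccessible_ordinal[OF that] by (simp add: ord_hier_def hier_emp)
  consider "fresh first_order_theory \<kappa>" | "fresh second_order_theory \<kappa>"
    | \<alpha> where "absolutely_definable \<alpha>" "fresh (alpha_order_theory \<alpha>) \<kappa>"
    using assms(2) by blast
  then show ?thesis
  proof cases
    case 1
    have "fresh (\<lambda>\<kappa>. fo_theory (elts (ord_hier emp \<kappa>))) \<kappa>"
      by (rule fresh_mono[OF 1]) (simp add: V first_order_theory_def)
    then show ?thesis
      by (rule fresh_definable_next_categorical[OF _ _ assms(3), rotated]) (intro defn)
  next
    case 2
    have "transitive_set (Vrank \<mu>) \<and> Vuniv \<mu> \<noteq> {}" if "inaccessible \<mu>" for \<mu> :: 'v
      using Vuniv_trans[OF that] Vuniv_emp[OF that] by (auto simp: transitive_set_def)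
    then have "fresh (\<lambda>\<kappa>. fo_theory (elts (vpow (ord_hier emp \<kappa>)))) \<kappa>"
      by (intro fresh_mono[OF 2]) (simp add: V second_order_theory_def so_theory_eqI del: elts_vpow)
    then show ?thesis
      by (rule fresh_definable_next_categorical[OF _ _ assms(3), rotated]) (intro defn)
  next
    case 3
    have "ordinal \<alpha>"
      using 3(1) by (simp add: absolutely_definable_def)
    \<comment> \<open>The inner \<open>ord_hier\<close> builds \<open>V\<^sub>\<kappa>\<close>, and
      the outer one adds \<open>\<alpha>\<close> further stages on top of it.\<close>
    then have "fresh (\<lambda>\<kappa>. fo_theory (elts (ord_hier (ord_hier emp \<kappa>) \<alpha>))) \<kappa>"
      by (intro fresh_mono[OF 3(2)])
        (simp add: V ord_hier_def[of _ \<alpha>] hier_Vrank alpha_order_theory_def)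
    then show ?thesis
      by (rule fresh_definable_next_categorical[OF _ _ assms(3), rotated])
        (intro defn definable_fun_absolutely_definable[OF 3(1)])
  qed
qed

end
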